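(* Let $K$ be a field, let $n_1<n_2<n_3<n_4$ be positive integers with $\gcd(n_1,n_2,n_3,n_4)=1$, and let $C$ be the monomial curve $x_i=t^{n_i}$ ($1\le i\le 4$) in $\mathbb{A}^4(K)$. Suppose that $a_in_i\neq a_jn_j$ for all $i\neq j$ (Case 1), and let $$S=\{x_1^{a_1}-\mathbf{x}^{\mathbf{u}},\ x_2^{a_2}-\mathbf{x}^{\mathbf{v}},\ x_3^{a_3}-\mathbf{x}^{\mathbf{w}},\ x_4^{a_4}-\mathbf{x}^{\mathbf{z}}\}$$ be a generating set of the critical ideal $\mathcal{C}_A$ consisting of critical binomials with respect to $x_1,x_2,x_3,x_4$ respectively. Assume that $1\in\mathrm{supp}(\mathbf{x}^{\mathbf{v}})$. Then in each of the following cases $C$ has Cohen-Macaulay tangent cone at the origin. (i) $1\in\mathrm{supp}(\mathbf{x}^{\mathbf{w}})$, $1\in\mathrm{supp}(\mathbf{x}^{\mathbf{z}})$ and (1) $a_2\le\deg(\mathbf{x}^{\mathbf{v}})$, (2) $a_3\le\deg(\mathbf{x}^{\mathbf{w}})$, and (3) for every binomial $f=M-N\in\mathcal{I}$ with $1\in\mathrm{supp}(M)$ we have $\deg(N)\le\deg(M)$. (ii) $1\in\mathrm{supp}(\mathbf{x}^{\mathbf{w}})$, $1\notin\mathrm{supp}(\mathbf{x}^{\mathbf{z}})$ and (1) $a_2\le\deg(\mathbf{x}^{\mathbf{v}})$, (2) $a_3\le\deg(\mathbf{x}^{\mathbf{w}})$, and (3) for every monomial $M=x_2^{d_2}x_3^{d_3}x_4^{d_4}$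 with $d_2<a_2$, $d_3<a_3$ and $d_2n_2+d_3n_3+d_4n_4\in n_1+\mathcal{S}$ there exists a monomial $N$ with $1\in\mathrm{supp}(N)$ such that $M-N\in I(C)$ and $\deg(M)\le\deg(N)$. (iii) $1\notin\mathrm{supp}(\mathbf{x}^{\mathbf{w}})$, $1\in\mathrm{supp}(\mathbf{x}^{\mathbf{z}})$ and (1) $a_2\le\deg(\mathbf{x}^{\mathbf{v}})$, and (2) for every monomial $M=x_2^{d_2}x_3^{d_3}x_4^{d_4}$ with $d_2<a_2$, $d_4<a_4$ and $d_2n_2+d_3n_3+d_4n_4\in n_1+\mathcal{S}$ there exists a monomial $N$ with $1\in\mathrm{supp}(N)$ such that $M-N\in I(C)$ and $\deg(M)\le\deg(N)$. (iv) $1\notin\mathrm{supp}(\mathbf{x}^{\mathbf{w}})$, $1\notin\mathrm{supp}(\mathbf{x}^{\mathbf{z}})$ and (1) $a_2\le\deg(\mathbf{x}^{\mathbf{v}})$, and (2) for every monomial $M=x_2^{d_2}x_3^{d_3}x_4^{d_4}$ with $d_2<a_2$ and $d_2n_2+d_3n_3+d_4n_4\in n_1+\mathcal{S}$ there exists a monomial $N$ with $1\in\mathrm{supp}(N)$ such that $M-N\in I(C)$ and $\deg(M)\le\deg(N)$.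
   Context: $\mathbb{N}$ denotes the non-negative integers, and all exponents $d_i$ are in $\mathbb{N}$. $A=\{n_1,\dots,n_4\}$; $\mathcal{S}=\{g_1n_1+\cdots+g_4n_4 : g_i\in\mathbb{N}\}$; $n_1+\mathcal{S}=\{n_1+m: m\in\mathcal{S}\}$. $I(C)$ is the kernel of the $K$-algebra homomorphism $K[x_1,\dots,x_4]\to K[t]$, $x_i\mapsto t^{n_i}$. For a monomial $\mathbf{x}^{\mathbf{u}}=x_1^{u_1}\cdots x_4^{u_4}$, $\deg(\mathbf{x}^{\mathbf{u}})=u_1+\cdots+u_4$ and $\mathrm{supp}(\mathbf{x}^{\mathbf{u}})=\{i: x_i\mid\mathbf{x}^{\mathbf{u}}\}$. $C$ has Cohen-Macaulay tangent cone at the origin if the ring $K[x_1,\dots,x_4]/I(C)_*$ is Cohen-Macaulay, where $I(C)_*$ is generated by the homogeneous (standard grading) summands $f_*$ of least degree of the polynomials $f\in I(C)$. For each $i$, $a_i$ is the least positive integer such that $a_in_i\in\sum_{j\neq i}\mathbb{N}n_j$; a binomial $x_i^{a_i}-\prod_{j\ne i}x_j^{u_{ij}}\in I(C)$ is called critical with respect to $x_i$, and the critical ideal $\mathcal{C}_A$ is the ideal of $K[x_1,\dots,x_4]$ generated by all critical binomials of $I(C)$. In Case 1 ($a_in_i\neq a_jn_j$ for all $i\ne j$), $\mathcal{C}_A$ is minimally generated by such a set $S$, where each of the monomials $\mathbf{x}^{\mathbf{u}},\mathbf{x}^{\mathbf{v}},\mathbf{x}^{\mathbf{w}},\mathbf{x}^{\mathbf{z}}$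 has support of cardinality at least two, and $S\cup\mathcal{I}$ is a minimal generating system of $I(C)$ (a theorem of Katsabekis and Ojeda), where $\mathcal{I}$ is the set of all binomials (taken up to sign) $x_{i_1}^{u_{i_1}}x_{i_2}^{u_{i_2}}-x_{i_3}^{u_{i_3}}x_{i_4}^{u_{i_4}}\in I(C)$ with $\{i_1,i_2,i_3,i_4\}=\{1,2,3,4\}$, $0<u_{i_j}<a_{i_j}$ for $j=1,2$, $u_{i_3}>0$, $u_{i_4}>0$, and $x_{i_3}^{u_{i_3}}x_{i_4}^{u_{i_4}}$ an indispensable monomial. A monomial is indispensable if every system of binomial generators of $I(C)$ contains a binomial having that monomial as one of its two terms. *)

theory Defs
  imports
    "HOL-Algebra.Algebra"
    "HOL-Algebra.Algebraic_Closure_Type"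
    "HOL-Library.Poly_Mapping"
    "HOL-Library.Extended_Nat"
    "HOL-Computational_Algebra.Polynomial"
begin

section \<open>Cohen--Macaulay rings\<close>

definition regular_sequence :: "('a, 'b) ring_scheme \<Rightarrow> 'a list \<Rightarrow> bool" where
  "regular_sequence R rs \<longleftrightarrow>
     set rs \<subseteq> carrier R \<and>
     (\<forall>i<length rs. \<forall>y\<in>carrier R.
        rs ! i \<otimes>\<^bsub>R\<^esub> y \<in> genideal R (set (take i rs)) \<longrightarrow> y \<in> genideal R (set (take i rs))) \<and>
     genideal R (set rs) \<noteq> carrier R"

definition ideal_depth :: "('a, 'b) ring_scheme \<Rightarrow> 'a set \<Rightarrow> enat" where
  "ideal_depth R I = Sup {enat (length rs) | rs. regular_sequence R rs \<and> set rs \<subseteq> I}"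

definition prime_height :: "('a, 'b) ring_scheme \<Rightarrow> 'a set \<Rightarrow> enat" where
  "prime_height R P =
     Sup {enat k | k. \<exists>Q. (\<forall>i\<le>k. primeideal (Q i) R) \<and> (\<forall>i<k. Q i \<subset> Q (Suc i)) \<and> Q k = P}"

text \<open>
  Eisenbud's form of the definition: a Noetherian ring is Cohen--Macaulay if depth and
  height (codimension) agree at every maximal ideal. No localization is needed, because neither
  number changes when one localizes at the maximal ideal in question.
\<close>

definition cohen_macaulay :: "('a, 'b) ring_scheme \<Rightarrow> bool" where
  "cohen_macaulay R \<longleftrightarrow>
     cring R \<and> noetherian_ring R \<and>
     (\<forall>P. maximalideal P R \<longrightarrow> ideal_depth R P = prime_height R P)"


section \<open>Polynomials in four variables\<close>

datatype xvar = X1 | X2 | X3 | X4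

lemma UNIV_xvar: "UNIV = {X1, X2, X3, X4}"
  using xvar.exhaust by auto

instance xvar :: finite
  by standard (simp add: UNIV_xvar)

text \<open>
  Monomials are identified with their exponent vectors; the support of a monomial \<open>m\<close> is
  \<open>keys m\<close>.
\<close>

type_synonym mon = "xvar \<Rightarrow>\<^sub>0 nat"
type_synonym 'k mpoly4 = "mon \<Rightarrow>\<^sub>0 'k"

abbreviation mpoly4_ring :: "'k::field mpoly4 ring" where
  "mpoly4_ring \<equiv> ring_of_type_algebra"

definition xpow :: "mon \<Rightarrow> 'k::field mpoly4" where
  "xpow m = Poly_Mapping.single m 1"

definition mdeg :: "mon \<Rightarrow> nat" where
  "mdeg m = (\<Sum>i\<in>UNIV. Poly_Mapping.lookup m i)"

definition initial_form :: "'k::field mpoly4 \<Rightarrow> 'k mpoly4" where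
  "initial_form f =
     (\<Sum>m\<in>{m \<in> Poly_Mapping.keys f. mdeg m = Min (mdeg ` Poly_Mapping.keys f)}.
        Poly_Mapping.single m (Poly_Mapping.lookup f m))"

definition initial_ideal :: "'k::field mpoly4 set \<Rightarrow> 'k mpoly4 set" where
  "initial_ideal I = genideal mpoly4_ring (initial_form ` I)"


section \<open>Monomial curves\<close>

definition semigroup_of :: "(xvar \<Rightarrow> nat) \<Rightarrow> nat set" where
  "semigroup_of n = {\<Sum>i\<in>UNIV. g i * n i | g :: xvar \<Rightarrow> nat. True}"

definition curve_hom :: "(xvar \<Rightarrow> nat) \<Rightarrow> 'k::field mpoly4 \<Rightarrow> 'k poly" where
  "curve_hom n f =
     (\<Sum>m\<in>Poly_Mapping.keys f.
        [:Poly_Mapping.lookup f m:] *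
        (\<Prod>i\<in>UNIV. Polynomial.monom 1 (n i) ^ Poly_Mapping.lookup m i))"

definition curve_ideal :: "(xvar \<Rightarrow> nat) \<Rightarrow> 'k::field mpoly4 set" where
  "curve_ideal n = {f. curve_hom n f = 0}"

definition cm_tangent_cone :: "'k::field itself \<Rightarrow> (xvar \<Rightarrow> nat) \<Rightarrow> bool" where
  "cm_tangent_cone _ n \<longleftrightarrow>
     cohen_macaulay ((mpoly4_ring :: 'k mpoly4 ring) Quot initial_ideal (curve_ideal n))"

definition crit_exp :: "(xvar \<Rightarrow> nat) \<Rightarrow> xvar \<Rightarrow> nat" where
  "crit_exp n i = (LEAST a. a > 0 \<and> (\<exists>g :: xvar \<Rightarrow> nat. a * n i = (\<Sum>j\<in>UNIV - {i}. g j * n j)))"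

definition crit_diff :: "(xvar \<Rightarrow> nat) \<Rightarrow> xvar \<Rightarrow> mon \<Rightarrow> 'k::field mpoly4" where
  "crit_diff n i m = xpow (Poly_Mapping.single i (crit_exp n i)) - xpow m"

definition critical_binomial :: "(xvar \<Rightarrow> nat) \<Rightarrow> xvar \<Rightarrow> 'k::field mpoly4 \<Rightarrow> bool" where
  "critical_binomial n i f \<longleftrightarrow>
     f \<in> curve_ideal n \<and> (\<exists>m. i \<notin> Poly_Mapping.keys m \<and> f = crit_diff n i m)"

definition critical_ideal :: "(xvar \<Rightarrow> nat) \<Rightarrow> 'k::field mpoly4 set" where
  "critical_ideal n = genideal mpoly4_ring {f. \<exists>i. critical_binomial n i f}"

definition is_binomial :: "'k::field mpoly4 \<Rightarrow> bool" where
  "is_binomial f \<longleftrightarrow> (\<exists>p q. p \<noteq> q \<and> f = xpow p - xpow q)"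

text \<open>The two terms of a binomial \<open>f\<close> are the elements of \<open>keys f\<close>.\<close>

definition indispensable :: "'k::field itself \<Rightarrow> (xvar \<Rightarrow> nat) \<Rightarrow> mon \<Rightarrow> bool" where
  "indispensable _ n m \<longleftrightarrow>
     (\<forall>B :: 'k mpoly4 set.
        (\<forall>f\<in>B. is_binomial f) \<and> genideal mpoly4_ring B = curve_ideal n \<longrightarrow>
        (\<exists>f\<in>B. m \<in> Poly_Mapping.keys f))"

text \<open>
  The set \<open>\<I>\<close> of binomials \<open>p - q\<close>, where \<open>p = x\<^bsub>i1\<^esub>\<^bsup>u1\<^esup> x\<^bsub>i2\<^esub>\<^bsup>u2\<^esup>\<close> and
  \<open>q = x\<^bsub>i3\<^esub>\<^bsup>u3\<^esup> x\<^bsub>i4\<^esub>\<^bsup>u4\<^esup>\<close>. Binomials are taken up to sign, which is rendered by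
  making the set closed under negation.
\<close>

definition indisp_binomials :: "(xvar \<Rightarrow> nat) \<Rightarrow> 'k::field mpoly4 set" where
  "indisp_binomials n =
     {f. f \<in> curve_ideal n \<and>
        (\<exists>i1 i2 i3 i4 u1 u2 u3 u4 p q.
           {i1, i2, i3, i4} = UNIV \<and>
           0 < u1 \<and> u1 < crit_exp n i1 \<and> 0 < u2 \<and> u2 < crit_exp n i2 \<and> 0 < u3 \<and> 0 < u4 \<and>
           p = Poly_Mapping.single i1 u1 + Poly_Mapping.single i2 u2 \<and>
           q = Poly_Mapping.single i3 u3 + Poly_Mapping.single i4 u4 \<and>
           indispensable TYPE('k) n q \<and>
           (f = xpow p - xpow q \<or> f = xpow q - xpow p))}"

text \<open>
  \<open>x\<^sub>2\<^bsup>d2\<^esup> x\<^sub>3\<^bsup>d3\<^esup> x\<^sub>4\<^bsup>d4\<^esup>\<close>, and the condition placed on it: if its weight lies in \<open>n\<^sub>1 + \<S>\<close>, it is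
  congruent modulo \<open>I(C)\<close> to a monomial of at least the same degree that is divisible by \<open>x\<^sub>1\<close>.
\<close>

definition mon234 :: "nat \<Rightarrow> nat \<Rightarrow> nat \<Rightarrow> mon" where
  "mon234 d2 d3 d4 =
     Poly_Mapping.single X2 d2 + Poly_Mapping.single X3 d3 + Poly_Mapping.single X4 d4"

definition liftable :: "'k::field itself \<Rightarrow> (xvar \<Rightarrow> nat) \<Rightarrow> nat \<Rightarrow> nat \<Rightarrow> nat \<Rightarrow> bool" where
  "liftable _ n d2 d3 d4 \<longleftrightarrow>
     (d2 * n X2 + d3 * n X3 + d4 * n X4 \<in> (\<lambda>m. n X1 + m) ` semigroup_of n \<longrightarrow>
      (\<exists>N. X1 \<in> Poly_Mapping.keys N \<and>
           xpow (mon234 d2 d3 d4) - xpow N \<in> (curve_ideal n :: 'k mpoly4 set) \<and>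
           mdeg (mon234 d2 d3 d4) \<le> mdeg N))"

end

theory Submission
  imports Defs
begin

text \<open>
  Give \<open>x\<^sub>i\<close> the weight \<open>n\<^sub>i\<close>. For a weight \<open>s\<close> in the semigroup let \<open>ord s\<close> (below: \<open>max_degree s\<close>) be the
  largest degree of a monomial of weight \<open>s\<close>. The coordinate ring of the tangent cone has a basis
  \<open>e\<^sub>s\<close> indexed by the semigroup, where \<open>e\<^sub>s e\<^sub>t\<close> is \<open>e\<^bsub>s+t\<^esub>\<close> if \<open>ord (s + t) = ord s + ord t\<close> and \<open>0\<close> otherwise.
  This is the content of \<open>initial_ideal_curve_ideal\<close>: a polynomial lies in the ideal of initial forms iff, in
  every weight, the coefficients of its monomials of maximal degree add up to zero.

  Since \<open>n\<^sub>1\<close> is the smallest weight, the initial form of \<open>x\<^sub>j^n\<^sub>1 - x\<^sub>1^n\<^sub>j\<close> for \<open>j \<noteq> 1\<close> is \<open>x\<^sub>j^n\<^sub>1\<close>, so on the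
  tangent cone \<open>x\<^sub>2, x\<^sub>3, x\<^sub>4\<close> are nilpotent. The ring is therefore a finite \<open>K[x\<^sub>1]\<close>-algebra which becomes \<open>K[x\<^sub>1]\<close>
  modulo nilpotents. If \<open>x\<^sub>1\<close> is a nonzerodivisor, it is torsion-free over \<open>K[x\<^sub>1]\<close>, and then every maximal ideal
  has depth and height one (locale \<open>line_thickening\<close>). That \<open>x\<^sub>1\<close> is a nonzerodivisor means
  \<open>ord (s + n\<^sub>1) = ord s + 1\<close> for all \<open>s\<close> (\<open>cm_tangent_coneI\<close>). It suffices that every monomial whose weight lies
  in \<open>n\<^sub>1 + S\<close> has a long mate: a monomial divisible by \<open>x\<^sub>1\<close>, of the same weight and at least the same degree
  (\<open>max_degree_plus_n_X1\<close>).

  In cases (ii) to (iv) the long mates of monomials with small exponents are given. A monomial with a large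
  exponent at \<open>x\<^sub>i\<close> gets one by trading \<open>x\<^sub>i\<close> to its critical exponent for the other term of the critical
  binomial; for \<open>x\<^sub>4\<close> the degree cannot drop because \<open>n\<^sub>4\<close> is the largest weight.

  In case (i) long mates have to be found, and it is enough to look at a monomial \<open>m\<close> that is minimal under
  divisibility among those of weight in \<open>n\<^sub>1 + S\<close> and has exponents below the critical ones. The critical
  binomials of \<open>x\<^sub>2, x\<^sub>3, x\<^sub>4\<close> contain \<open>x\<^sub>1\<close>, and this forces every other monomial of the weight of \<open>m\<close> to be coprime to \<open>m\<close>
  (\<open>minimal_with_x1_mate_isolated\<close>). Hence \<open>m\<close> is indispensable, and a mate with the largest possible power
  of \<open>x\<^sub>1\<close> is either a power of \<open>x\<^sub>1\<close>, which is long, or gives together with \<open>m\<close> one of the binomials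
  of \<open>\<I>\<close>, so that it is long by hypothesis.
\<close>

section \<open>Nilpotent thickenings of the affine line\<close>

text \<open>Stated for a bare set of polynomials, because it is applied to contracted ideals and to
  the coefficients that elements of a submodule have at a generator.\<close>

lemma poly_ideal_generator:
  fixes A :: "'k::field poly set"
  assumes "0 \<in> A" and add: "\<And>p q. p \<in> A \<Longrightarrow> q \<in> A \<Longrightarrow> p + q \<in> A"
    and mult: "\<And>p q. q \<in> A \<Longrightarrow> p * q \<in> A"
  obtains f where "f \<in> A" "\<And>p. p \<in> A \<Longrightarrow> f dvd p"
proof (cases "A = {0}")
  case True
  then show ?thesis using that[of 0] by auto
next
  case False
  with \<open>0 \<in> A\<close> obtain p where "p \<in> A \<and> p \<noteq> 0" by blast
  then obtain f where f: "f \<in> A" "f \<noteq> 0"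
    and min: "\<And>q. q \<in> A \<Longrightarrow> q \<noteq> 0 \<Longrightarrow> Polynomial.degree f \<le> Polynomial.degree q"
    using ex_has_least_nat[of "\<lambda>q. q \<in> A \<and> q \<noteq> 0" p Polynomial.degree] by blast
  have "f dvd p" if "p \<in> A" for p
  proof (rule ccontr)
    assume "\<not> f dvd p"
    then have r: "p mod f \<noteq> 0" by (simp add: dvd_eq_mod_eq_0)
    have "p mod f = p + (- (p div f)) * f" by (simp add: minus_mult_div_eq_mod [symmetric] mult.commute)
    then have "p mod f \<in> A" using that f add mult by metis
    with min r have "Polynomial.degree f \<le> Polynomial.degree (p mod f)" by blast
    then show False using degree_mod_less[of f p] f r by simp
  qed
  with f that show ?thesis by blast
qed

context cring
begin

definition nilpotent :: "'a \<Rightarrow> bool" where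
  "nilpotent r \<longleftrightarrow> r \<in> carrier R \<and> (\<exists>k::nat. r [^] k = \<zero>)"

text \<open>Stands in for the binomial theorem: modulo an ideal, powers only depend on the residue
  class.\<close>

lemma pow_cong_ideal:
  assumes "ideal I R" "x \<in> carrier R" "y \<in> carrier R" "x \<ominus> y \<in> I"
  shows "x [^] (k::nat) \<ominus> y [^] k \<in> I"
proof (induction k)
  case 0
  interpret ideal I R by fact
  show ?case by (simp add: r_neg minus_eq)
next
  case (Suc k)
  interpret ideal I R by fact
  have "x [^] Suc k \<ominus> y [^] Suc k = (x [^] k \<ominus> y [^] k) \<otimes> x \<oplus> y [^] k \<otimes> (x \<ominus> y)"
  proof -
    have *: "A \<otimes> x \<ominus> B \<otimes> y = (A \<ominus> B) \<otimes> x \<oplus> B \<otimes> (x \<ominus> y)"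
      if "A \<in> carrier R" "B \<in> carrier R" for A B
      using that assms(2,3) by algebra
    show ?thesis using assms(2,3) by (simp add: *)
  qed
  then show ?case
    using Suc assms by (simp add: I_l_closed I_r_closed)
qed

lemma nilpotent_mult:
  assumes "nilpotent r" "s \<in> carrier R"
  shows "nilpotent (s \<otimes> r)"
proof -
  obtain k :: nat where "r [^] k = \<zero>" "r \<in> carrier R" using assms(1) by (auto simp: nilpotent_def)
  then have "(s \<otimes> r) [^] k = \<zero>" using assms(2) by (simp add: nat_pow_distrib)
  then show ?thesis using assms by (auto simp: nilpotent_def)
qed

text \<open>Modulo \<open>s\<close> the elements \<open>r + s\<close> and \<open>r\<close> agree, so a power of \<open>r + s\<close> is a multiple of \<open>s\<close>;
  raising it once more kills it.\<close>

lemma nilpotent_add: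
  assumes "nilpotent r" "nilpotent s"
  shows "nilpotent (r \<oplus> s)"
proof -
  obtain k l :: nat where kl: "r [^] k = \<zero>" "s [^] l = \<zero>" and c: "r \<in> carrier R" "s \<in> carrier R"
    using assms by (auto simp: nilpotent_def)
  interpret I: ideal "PIdl s" R by (rule cgenideal_ideal[OF c(2)])
  have "(r \<oplus> s) \<ominus> r = s" using c by algebra
  then have "(r \<oplus> s) [^] k \<ominus> r [^] k \<in> PIdl s"
    using c by (intro pow_cong_ideal I.is_ideal) (auto simp: cgenideal_self)
  then have "(r \<oplus> s) [^] k \<in> PIdl s" using c kl by (simp add: minus_eq)
  then obtain x where x: "x \<in> carrier R" "(r \<oplus> s) [^] k = x \<otimes> s" unfolding cgenideal_def by blast
  have "(r \<oplus> s) [^] (k * l) = (x \<otimes> s) [^] l" using c x by (simp flip: nat_pow_pow)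
  also have "\<dots> = \<zero>" using x c kl by (simp add: nat_pow_distrib)
  finally show ?thesis using c by (auto simp: nilpotent_def)
qed

lemma nilpotents_ideal: "ideal {r. nilpotent r} R"
proof (rule idealI)
  have inv: "nilpotent (\<ominus> r)" if "nilpotent r" for r
    using nilpotent_mult[OF that, of "\<ominus> \<one>"] that by (simp add: nilpotent_def l_minus)
  show "subgroup {r. nilpotent r} (add_monoid R)"
    by (rule subgroup.intro)
      (auto simp: nilpotent_add inv[unfolded a_inv_def] intro: exI[of _ "1::nat"],
       auto simp: nilpotent_def intro: exI[of _ "1::nat"])
next
  fix r s assume "r \<in> {r. nilpotent r}" and s: "s \<in> carrier R"
  then have r: "nilpotent r" "r \<in> carrier R" by (auto simp: nilpotent_def)
  then show "s \<otimes> r \<in> {r. nilpotent r}" "r \<otimes> s \<in> {r. nilpotent r}"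
    using nilpotent_mult[OF r(1) s] m_comm[OF r(2) s] by simp_all
qed (rule ring_axioms)

lemma nilpotent_in_primeideal:
  assumes "primeideal Q R" "nilpotent r"
  shows "r \<in> Q"
proof -
  interpret Q: primeideal Q R by fact
  obtain k :: nat where k: "r [^] k = \<zero>" and r: "r \<in> carrier R" using assms by (auto simp: nilpotent_def)
  have "r [^] k \<in> Q \<Longrightarrow> r \<in> Q"
  proof (induction k)
    case 0
    then show ?case using Q.I_notcarr Q.one_imp_carrier by auto
  next
    case (Suc k)
    then show ?case using Q.I_prime[of "r [^] k" r] r by auto
  qed
  then show ?thesis using k Q.zero_closed by simp
qed

end

text \<open>Geometrically, a nilpotent thickening of the affine line without embedded points: \<open>\<iota>\<close> embeds
  \<open>K[x]\<close>, and up to nilpotents there is nothing else. Torsion-freeness over \<open>K[x]\<close> is what gives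
  positive depth.\<close>

locale line_thickening = cring R for R (structure) +
  fixes \<iota> :: "'k::field poly \<Rightarrow> 'a"
  assumes \<iota>_closed [simp, intro]: "\<iota> p \<in> carrier R"
    and \<iota>_add: "\<iota> (p + q) = \<iota> p \<oplus> \<iota> q"
    and \<iota>_mult: "\<iota> (p * q) = \<iota> p \<otimes> \<iota> q"
    and \<iota>_one: "\<iota> 1 = \<one>"
    and one_neq_zero: "\<one> \<noteq> \<zero>"
    and torsion_free: "y \<in> carrier R \<Longrightarrow> p \<noteq> 0 \<Longrightarrow> \<iota> p \<otimes> y = \<zero> \<Longrightarrow> y = \<zero>"
    and poly_plus_nilpotent: "r \<in> carrier R \<Longrightarrow> \<exists>p. nilpotent (r \<ominus> \<iota> p)"
begin

lemma \<iota>_zero: "\<iota> 0 = \<zero>"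
proof -
  have "\<iota> 0 \<oplus> \<iota> 0 = \<iota> 0" by (simp flip: \<iota>_add)
  then show ?thesis using \<iota>_closed[of 0] by (metis add.r_cancel_one)
qed

lemma \<iota>_uminus: "\<iota> (- p) = \<ominus> \<iota> p"
proof -
  have "\<iota> (- p) \<oplus> \<iota> p = \<zero>" by (simp add: \<iota>_zero flip: \<iota>_add)
  then show ?thesis by (metis \<iota>_closed minus_equality)
qed

lemma \<iota>_power: "\<iota> (p ^ k) = \<iota> p [^] k"
  by (induction k) (simp_all add: \<iota>_one \<iota>_mult m_comm)

lemma nilpotent_\<iota>_iff: "nilpotent (\<iota> p) \<longleftrightarrow> p = 0"
proof
  assume "nilpotent (\<iota> p)"
  then obtain k :: nat where "\<iota> p [^] k = \<zero>" by (auto simp: nilpotent_def)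
  moreover have False if "p \<noteq> 0" "\<iota> p [^] k = \<zero>" for k :: nat
    using that(2)
  proof (induction k)
    case 0
    then show ?case by (simp add: one_neq_zero)
  next
    case (Suc k)
    then have "\<iota> p \<otimes> \<iota> p [^] k = \<zero>" by (simp add: m_comm)
    then show ?case using Suc torsion_free[of "\<iota> p [^] k" p] that(1) by simp
  qed
  ultimately show "p = 0" by blast
qed (auto simp: \<iota>_zero nilpotent_def intro: exI[of _ "1::nat"])

text \<open>The ideal \<open>I \<inter> K[x]\<close> is principal; the generator may be \<open>0\<close>.\<close>

lemma contraction_generator:
  assumes "ideal I R"
  obtains f where "\<And>p. \<iota> p \<in> I \<longleftrightarrow> f dvd p"
proof -
  interpret ideal I R by fact
  obtain f where "f \<in> {p. \<iota> p \<in> I}" "\<And>p. p \<in> {p. \<iota> p \<in> I} \<Longrightarrow> f dvd p"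
    by (rule poly_ideal_generator[of "{p. \<iota> p \<in> I}"]) (auto simp: \<iota>_zero \<iota>_add \<iota>_mult I_l_closed)
  then have "\<iota> p \<in> I \<longleftrightarrow> f dvd p" for p
    by (auto simp: \<iota>_mult I_r_closed elim!: dvdE)
  then show ?thesis using that by blast
qed

lemma mem_primeideal_iff:
  assumes "primeideal Q R" "r \<in> carrier R" "nilpotent (r \<ominus> \<iota> p)"
  shows "r \<in> Q \<longleftrightarrow> \<iota> p \<in> Q"
proof -
  interpret Q: primeideal Q R by fact
  have n: "r \<ominus> \<iota> p \<in> Q" using assms nilpotent_in_primeideal by blast
  have "r = (r \<ominus> \<iota> p) \<oplus> \<iota> p" "\<iota> p = r \<oplus> \<ominus> (r \<ominus> \<iota> p)" using assms(2) \<iota>_closed[of p] by algebra+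
  then show ?thesis using n by (metis Q.a_closed Q.a_inv_closed)
qed

text \<open>A prime contains the nilpotents, so it is determined by its contraction to \<open>K[x]\<close>.\<close>

lemma primeideals_eqI:
  assumes "primeideal Q R" "primeideal Q' R" "\<And>p. \<iota> p \<in> Q \<longleftrightarrow> \<iota> p \<in> Q'"
  shows "Q = Q'"
proof -
  interpret Q: primeideal Q R by fact
  interpret Q': primeideal Q' R by fact
  have "r \<in> Q \<longleftrightarrow> r \<in> Q'" if "r \<in> carrier R" for r
    using poly_plus_nilpotent[OF that] that assms mem_primeideal_iff by metis
  then show ?thesis using Q.Icarr Q'.Icarr by blast
qed

text \<open>Reduction modulo nilpotents is \<open>K[x]\<close>, a domain.\<close>

lemma nilradical_prime: "primeideal {r. nilpotent r} R"
proof (rule primeidealI)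
  show "carrier R \<noteq> {r. nilpotent r}"
    using nilpotent_\<iota>_iff[of 1] by (auto simp: \<iota>_one)
  fix a b assume c: "a \<in> carrier R" "b \<in> carrier R" and ab: "a \<otimes> b \<in> {r. nilpotent r}"
  interpret N: ideal "{r. nilpotent r}" R by (rule nilpotents_ideal)
  obtain p q where pq: "nilpotent (a \<ominus> \<iota> p)" "nilpotent (b \<ominus> \<iota> q)" 
    using poly_plus_nilpotent c by metis
  have "\<iota> (p * q) = a \<otimes> b \<oplus> \<ominus> (b \<otimes> (a \<ominus> \<iota> p) \<oplus> \<iota> p \<otimes> (b \<ominus> \<iota> q))"
    unfolding \<iota>_mult using c \<iota>_closed[of p] \<iota>_closed[of q] by algebra
  moreover have "b \<otimes> (a \<ominus> \<iota> p) \<oplus> \<iota> p \<otimes> (b \<ominus> \<iota> q) \<in> {r. nilpotent r}"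
    using pq c by (simp add: nilpotent_mult nilpotent_add)
  ultimately have "nilpotent (\<iota> (p * q))"
    using ab N.a_closed N.a_inv_closed by fastforce
  then have "p = 0 \<or> q = 0" by (simp add: nilpotent_\<iota>_iff)
  then show "a \<in> {r. nilpotent r} \<or> b \<in> {r. nilpotent r}"
    using pq c by (auto simp: \<iota>_zero minus_eq)
qed (rule nilpotents_ideal, rule is_cring)

text \<open>Dimension one: if \<open>f\<close> and \<open>f'\<close> generate the contractions of \<open>Q \<subset> Q'\<close>, then \<open>f = f' c\<close> and
  \<open>f\<close> divides \<open>f'\<close> or \<open>c\<close>. The former gives \<open>Q = Q'\<close>; the latter forces \<open>f = 0\<close>.\<close>

lemma smaller_primeideal_eq_nilradical:
  assumes Q: "primeideal Q R" and Q': "primeideal Q' R" and sub: "Q \<subset> Q'"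
  shows "Q = {r. nilpotent r}"
proof -
  interpret Q: primeideal Q R by fact
  interpret Q': primeideal Q' R by fact
  obtain f where f: "\<And>p. \<iota> p \<in> Q \<longleftrightarrow> f dvd p" using contraction_generator Q.is_ideal by blast
  obtain f' where f': "\<And>p. \<iota> p \<in> Q' \<longleftrightarrow> f' dvd p" using contraction_generator Q'.is_ideal by blast
  have "f' dvd f" using f[of f] f'[of f] sub by auto
  then obtain c where c: "f = f' * c" by (rule dvdE)
  have "f dvd f' \<or> f dvd c" using f c Q.I_prime[of "\<iota> f'" "\<iota> c"] by (auto simp flip: \<iota>_mult)
  moreover have "\<not> f dvd f'"
  proof
    assume "f dvd f'"
    then have "f dvd p \<longleftrightarrow> f' dvd p" for p using \<open>f' dvd f\<close> by (metis dvd_trans)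
    then have "Q = Q'" by (intro primeideals_eqI[OF Q Q']) (simp add: f f')
    with sub show False by simp
  qed
  ultimately obtain d where "c = f * d" by (auto elim: dvdE)
  then have "f = f * (f' * d)" using c by (simp add: mult.left_commute)
  then have "f * (1 - f' * d) = 0" by (simp add: right_diff_distrib del: mult_cancel_left2 mult_cancel_left1)
  then have "f = 0 \<or> 1 - f' * d = 0" by (rule mult_eq_0_iff[THEN iffD1])
  moreover have "\<not> is_unit f'"
    using f' [of 1] Q'.one_imp_carrier Q'.I_notcarr by (auto simp: \<iota>_one)
  then have "f' * d \<noteq> 1" by (metis dvd_triv_left)
  ultimately have "f = 0" by simp
  then have "\<iota> p \<in> Q \<longleftrightarrow> \<iota> p \<in> {r. nilpotent r}" for p
    by (simp add: f nilpotent_\<iota>_iff)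
  then show ?thesis by (rule primeideals_eqI[OF Q nilradical_prime])
qed

text \<open>A maximal ideal with contraction \<open>0\<close> would not contain \<open>x\<close>, so \<open>x\<close> would be invertible
  modulo it. Since every element is a polynomial up to a nilpotent, \<open>1 - q x\<close> would then be \<open>0\<close>
  for some polynomial \<open>q\<close>.\<close>

lemma maximalideal_contraction:
  assumes "maximalideal P R"
  shows "\<exists>f. f \<noteq> 0 \<and> \<not> is_unit f \<and> (\<forall>p. \<iota> p \<in> P \<longleftrightarrow> f dvd p)"
proof -
  interpret P: maximalideal P R by fact
  have prime: "primeideal P R" using maximalideal_prime assms .
  then interpret P': primeideal P R .
  obtain f where f: "\<And>p. \<iota> p \<in> P \<longleftrightarrow> f dvd p" using contraction_generator P.is_ideal by blast
  have unit: "\<not> is_unit f"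
    using f[of 1] P.one_imp_carrier P.I_notcarr by (auto simp: \<iota>_one)
  have "f \<noteq> 0"
  proof
    assume "f = 0"
    let ?X = "[:0, 1:] :: 'k poly"
    let ?J = "set_add R P (PIdl (\<iota> ?X))"
    have J: "x \<in> ?J \<longleftrightarrow> (\<exists>m\<in>P. \<exists>y\<in>carrier R. x = m \<oplus> y \<otimes> \<iota> ?X)" for x
      by (auto simp: set_add_def' cgenideal_def)
    have J_ideal: "ideal ?J R" using add_ideals P.is_ideal cgenideal_ideal by blast
    have sub:  "P \<subseteq> ?J"
    proof
      fix x assume x: "x \<in> P"
      then have "x = x \<oplus> \<zero> \<otimes> \<iota> ?X" using P.Icarr[OF x] by simp
      then show "x \<in> ?J" unfolding J using x zero_closed by (intro bexI)
    qed
    have "\<iota> ?X \<in> ?J"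
    proof -
      have "\<iota> ?X = \<zero> \<oplus> \<one> \<otimes> \<iota> ?X" by simp
      then show ?thesis unfolding J using P.zero_closed one_closed by (intro bexI)
    qed
    moreover have "\<iota> ?X \<notin> P" using f \<open>f = 0\<close> by simp
    ultimately have "?J \<noteq> P" by auto
    moreover have "?J \<subseteq> carrier R" by (rule subsetI) (rule ideal.Icarr[OF J_ideal])
    ultimately have "?J = carrier R" using P.I_maximal[OF J_ideal sub] by simp
    then have "\<one> \<in> ?J" by simp
    then obtain m y where my: "m \<in> P" "y \<in> carrier R" "\<one> = m \<oplus> y \<otimes> \<iota> ?X"
      unfolding J by blast
    obtain q where q: "nilpotent (y \<ominus> \<iota> q)" using poly_plus_nilpotent my by blast
    have "\<iota> (1 - q * ?X) = \<iota> 1 \<oplus> \<ominus> \<iota> (q * ?X)"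
      by (metis \<iota>_add \<iota>_uminus diff_conv_add_uminus)
    also have "\<dots> = (m \<oplus> y \<otimes> \<iota> ?X) \<oplus> \<ominus> (\<iota> q \<otimes> \<iota> ?X)" unfolding \<iota>_one \<iota>_mult using my by simp
    also have "\<dots> = m \<oplus> (y \<ominus> \<iota> q) \<otimes> \<iota> ?X" 
      using my P.Icarr[OF my(1)] \<iota>_closed[of q] \<iota>_closed[of ?X] by algebra
    also have "\<dots> \<in> P"
      using my nilpotent_in_primeideal[OF prime q] by (simp add: P.I_r_closed)
    finally have "1 - q * ?X = 0" using f \<open>f = 0\<close> by simp
    then have "is_unit ?X" by (metis dvd_triv_right eq_iff_diff_eq_0)
    then show False by (simp add: is_unit_iff_degree)
  qed
  then show ?thesis using f unit by blast
qed

lemma prime_height_maximalideal: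
  assumes "maximalideal P R"
  shows "prime_height R P = 1"
proof -
  have prime: "primeideal P R" using maximalideal_prime assms .
  obtain f where f: "f \<noteq> 0" "\<not> is_unit f" "\<And>p. \<iota> p \<in> P \<longleftrightarrow> f dvd p"
    using maximalideal_contraction[OF assms] by auto
  have "{r. nilpotent r} \<subseteq> P" using nilpotent_in_primeideal[OF prime] by blast
  moreover have "\<iota> f \<in> P" "\<not> nilpotent (\<iota> f)" using f(1) by (simp_all add: f(3) nilpotent_\<iota>_iff)
  ultimately have sub: "{r. nilpotent r} \<subset> P" by blast
  have "\<exists>Q. (\<forall>i\<le>1. primeideal (Q i) R) \<and> (\<forall>i<1. Q i \<subset> Q (Suc i)) \<and> Q (1::nat) = P"
    using prime nilradical_prime sub
    by (intro exI[of _ "\<lambda>i. if i = 0 then {r. nilpotent r} else P"]) auto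
  then have ge: "enat 1 \<le> prime_height R P"
    unfolding prime_height_def by (intro Sup_upper) blast
  have "k \<le> 1" if Q: "\<forall>i\<le>k. primeideal (Q i) R" "\<forall>i<k. Q i \<subset> Q (Suc i)" for Q k
  proof (rule ccontr)
    assume "\<not> k \<le> 1"
    then have "Q 0 \<subset> Q 1" "Q 1 \<subset> Q 2" "primeideal (Q 0) R" "primeideal (Q 1) R" "primeideal (Q 2) R"
      using Q(1) Q(2)[rule_format, of 0] Q(2)[rule_format, of 1] by (auto simp: numeral_2_eq_2)
    then show False
      using smaller_primeideal_eq_nilradical[of "Q 0" "Q 1"] smaller_primeideal_eq_nilradical[of "Q 1" "Q 2"]
      by simp
  qed
  then have "prime_height R P \<le> enat 1"
    unfolding prime_height_def by (intro Sup_least) auto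
  with ge show ?thesis by (simp add: one_enat_def)
qed

text \<open>Depth at most one. The polynomial part of \<open>a\<close> is some \<open>g\<close> divisible by \<open>f\<close>, and since
  \<open>a - g\<close> is nilpotent, some \<open>g^L\<close> lies in the ideal of \<open>a\<close>. Write \<open>g^L = f^E g'\<close> with \<open>f\<close> not
  dividing \<open>g'\<close>. A power of \<open>b\<close> is a multiple of \<open>f\<close>, hence a further power of \<open>b\<close> takes \<open>g'\<close>
  into the ideal of \<open>a\<close>. Regularity of \<open>b\<close> would put \<open>g'\<close> there, and so into \<open>P\<close>.\<close>

lemma no_regular_pair:
  assumes P: "primeideal P R" and f: "f \<noteq> 0" "\<not> is_unit f" "\<And>p. \<iota> p \<in> P \<longleftrightarrow> f dvd p"
    and ab: "a \<in> P" "b \<in> P"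
    and a_reg: "\<And>y. y \<in> carrier R \<Longrightarrow> a \<otimes> y = \<zero> \<Longrightarrow> y = \<zero>"
    and b_reg: "\<And>y. y \<in> carrier R \<Longrightarrow> b \<otimes> y \<in> PIdl a \<Longrightarrow> y \<in> PIdl a"
  shows False
proof -
  interpret P: primeideal P R by fact
  interpret N: ideal "{r. nilpotent r}" R by (rule nilpotents_ideal)
  have c: "a \<in> carrier R" "b \<in> carrier R" using ab P.Icarr by auto
  interpret A: ideal "PIdl a" R by (rule cgenideal_ideal[OF c(1)])
  obtain g where g: "nilpotent (a \<ominus> \<iota> g)" using poly_plus_nilpotent c by blast
  have "g \<noteq> 0"
  proof
    assume "g = 0"
    then have "nilpotent a" using g c by (simp add: \<iota>_zero minus_eq)
    then obtain k :: nat where k: "a [^] k = \<zero>" unfolding nilpotent_def by blast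
    have "a [^] k = \<zero> \<Longrightarrow> False" for k :: nat
    proof (induction k)
      case 0
      then show ?case by (simp add: one_neq_zero)
    next
      case (Suc k)
      have "a \<otimes> a [^] k = \<zero>" using Suc.prems c by (simp add: m_comm)
      then have "a [^] k = \<zero>" using a_reg[OF nat_pow_closed[OF c(1)]] by blast
      then show ?case by (rule Suc.IH)
    qed
    with k show False by blast
  qed
  have "nilpotent (\<iota> g \<ominus> a)"
  proof -
    have "\<iota> g \<ominus> a = \<ominus> (a \<ominus> \<iota> g)" using c \<iota>_closed[of g] by algebra
    then show ?thesis using g N.a_inv_closed by simp
  qed
  then obtain L :: nat where L: "(\<iota> g \<ominus> a) [^] L = \<zero>" unfolding nilpotent_def by blast
  have "\<iota> g \<ominus> (\<iota> g \<ominus> a) = a" using c \<iota>_closed[of g] by algebra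
  then have "\<iota> g [^] L \<ominus> (\<iota> g \<ominus> a) [^] L \<in> PIdl a"
    using c by (intro pow_cong_ideal A.is_ideal) (auto simp: cgenideal_self)
  then have gL: "\<iota> (g ^ L) \<in> PIdl a"
    using L by (simp add: \<iota>_power minus_eq)
  obtain E where E: "f ^ E dvd g ^ L" "\<not> f ^ Suc E dvd g ^ L"
  proof -
    have "e \<le> Polynomial.degree (g ^ L)" if "f ^ e dvd g ^ L" for e
    proof -
      have "Polynomial.degree (f ^ e) \<le> Polynomial.degree (g ^ L)"
        using dvd_imp_degree_le[OF that] \<open>g \<noteq> 0\<close> by simp
      moreover have "Polynomial.degree f \<noteq> 0" using f by (simp add: is_unit_iff_degree)
      moreover have "e \<le> e * Polynomial.degree f" using calculation(2) by simp
      ultimately show ?thesis using degree_power_eq[OF f(1), of e] by linarith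
    qed
    then have "\<exists>e. f ^ e dvd g ^ L \<and> (\<forall>e'. f ^ e' dvd g ^ L \<longrightarrow> e' \<le> e)"
      by (intro Nat.ex_has_greatest_nat[of _ 0]) auto
    then show ?thesis using that by (metis not_less_eq_eq order_refl)
  qed
  from E(1) obtain g' where g': "g ^ L = f ^ E * g'" by (rule dvdE)
  have ndvd: "\<not> f dvd g'" using E(2) by (auto simp: g' mult.commute intro: mult_dvd_mono)
  obtain h where h: "nilpotent (b \<ominus> \<iota> h)" using poly_plus_nilpotent c by blast
  then obtain L' :: nat where L': "(b \<ominus> \<iota> h) [^] L' = \<zero>" unfolding nilpotent_def by blast
  interpret F: ideal "PIdl (\<iota> f)" R by (rule cgenideal_ideal) simp
  have "f dvd h" using mem_primeideal_iff[OF P c(2) h] ab f by simp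
  then obtain d where "h = d * f" by (metis dvdE mult.commute)
  then have "\<iota> h = \<iota> d \<otimes> \<iota> f" by (simp only: \<iota>_mult)
  then have hF: "\<iota> h \<in> PIdl (\<iota> f)"
    using F.I_l_closed[OF cgenideal_self[OF \<iota>_closed] \<iota>_closed] by (simp only:)
  have "b \<ominus> (b \<ominus> \<iota> h) = \<iota> h" using c \<iota>_closed[of h] by algebra
  then have "b [^] L' \<ominus> (b \<ominus> \<iota> h) [^] L' \<in> PIdl (\<iota> f)"
    using c hF by (intro pow_cong_ideal F.is_ideal) auto
  then have "b [^] L' \<in> PIdl (\<iota> f)" using L' c by (simp add: minus_eq)
  then obtain x where x: "x \<in> carrier R" "b [^] L' = x \<otimes> \<iota> f" unfolding cgenideal_def by blast
  have "b [^] (L' * E) \<otimes> \<iota> g' = (x \<otimes> \<iota> f) [^] E \<otimes> \<iota> g'" using c x by (simp flip: nat_pow_pow)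
  also have "\<dots> = x [^] E \<otimes> \<iota> (f ^ E * g')" using x by (simp add: nat_pow_distrib \<iota>_mult \<iota>_power m_assoc)
  also have "\<dots> \<in> PIdl a" using x gL g' by (simp add: A.I_l_closed)
  finally have "b [^] (L' * E) \<otimes> \<iota> g' \<in> PIdl a" .
  moreover have "b [^] k \<otimes> \<iota> g' \<in> PIdl a \<Longrightarrow> \<iota> g' \<in> PIdl a" for k :: nat
  proof (induction k)
    case (Suc k)
    have "b [^] Suc k \<otimes> \<iota> g' = b \<otimes> (b [^] k \<otimes> \<iota> g')"
      using c by (simp add: m_assoc m_comm m_lcomm)
    with Suc show ?case using b_reg[of "b [^] k \<otimes> \<iota> g'"] c by simp
  qed simp
  ultimately have "\<iota> g' \<in> PIdl a" by blast
  then have "\<iota> g' \<in> P" using cgenideal_minimal[OF P.is_ideal ab(1)] by blast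
  then show False using f ndvd by simp
qed

lemma ideal_depth_maximalideal:
  assumes "maximalideal P R"
  shows "ideal_depth R P = 1"
proof -
  interpret P: maximalideal P R by fact
  have prime: "primeideal P R" using maximalideal_prime assms .
  obtain f where f: "f \<noteq> 0" "\<not> is_unit f" "\<And>p. \<iota> p \<in> P \<longleftrightarrow> f dvd p"
    using maximalideal_contraction[OF assms] by auto
  have Idl_empty: "Idl {} = {\<zero>}"
    using genideal_minimal[OF zeroideal, of "{}"] additive_subgroup.zero_closed[OF ideal.axioms(1)[OF genideal_ideal[of "{}"]]]
    by auto
  have "\<iota> f \<in> P" by (simp add: f)
  then have "Idl {\<iota> f} \<noteq> carrier R"
    using genideal_minimal[OF P.is_ideal, of "{\<iota> f}"] P.I_notcarr P.Icarr by blast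
  then have "regular_sequence R [\<iota> f]"
    using torsion_free[OF _ f(1)] by (auto simp: regular_sequence_def Idl_empty)
  then have ge: "enat 1 \<le> ideal_depth R P"
    unfolding ideal_depth_def using \<open>\<iota> f \<in> P\<close> by (intro Sup_upper) (auto intro!: exI[of _ "[\<iota> f]"])
  have "length rs \<le> 1" if rs: "regular_sequence R rs" "set rs \<subseteq> P" for rs
  proof (rule ccontr)
    assume "\<not> length rs \<le> 1"
    then obtain a b rs' where ab: "rs = a # b # rs'"
      by (metis One_nat_def length_Cons list.size(3) neq_Nil_conv not_less_eq_eq zero_le)
    have c: "a \<in> carrier R" using rs ab by (auto simp: regular_sequence_def)
    have a_reg: "y = \<zero>" if "y \<in> carrier R" "a \<otimes> y = \<zero>" for y
      using rs(1) that unfolding regular_sequence_def ab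
      by (auto dest!: spec[of _ 0] simp: Idl_empty)
    have b_reg: "y \<in> PIdl a" if "y \<in> carrier R" "b \<otimes> y \<in> PIdl a" for y
      using rs(1) that unfolding regular_sequence_def ab
      by (auto dest!: spec[of _ 1] simp: cgenideal_eq_genideal[OF c])
    have "a \<in> P" "b \<in> P" using rs(2) ab by auto
    with a_reg b_reg f show False by (intro no_regular_pair[OF prime, of f a b])
  qed
  then have "ideal_depth R P \<le> enat 1"
    unfolding ideal_depth_def by (intro Sup_least) auto
  with ge show ?thesis by (simp add: one_enat_def)
qed

fun \<iota>_span :: "'a list \<Rightarrow> 'a set" where
  "\<iota>_span [] = {\<zero>}"
| "\<iota>_span (g # gs) = {\<iota> p \<otimes> g \<oplus> s | p s. s \<in> \<iota>_span gs}"

definition \<iota>_submodule :: "'a set \<Rightarrow> bool" where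
  "\<iota>_submodule M \<longleftrightarrow> M \<subseteq> carrier R \<and> \<zero> \<in> M \<and> (\<forall>x\<in>M. \<forall>y\<in>M. x \<oplus> y \<in> M) \<and> (\<forall>p. \<forall>x\<in>M. \<iota> p \<otimes> x \<in> M)"

lemma submodule_\<iota>_span: "set gs \<subseteq> carrier R \<Longrightarrow> \<iota>_submodule (\<iota>_span gs)"
proof (induction gs)
  case Nil
  then show ?case by (simp add: \<iota>_submodule_def)
next
  case (Cons g gs)
  then have IH: "\<iota>_span gs \<subseteq> carrier R" "\<zero> \<in> \<iota>_span gs"
    "\<And>x y. x \<in> \<iota>_span gs \<Longrightarrow> y \<in> \<iota>_span gs \<Longrightarrow> x \<oplus> y \<in> \<iota>_span gs"
    "\<And>p x. x \<in> \<iota>_span gs \<Longrightarrow> \<iota> p \<otimes> x \<in> \<iota>_span gs" and g: "g \<in> carrier R"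
    by (auto simp: \<iota>_submodule_def)
  show ?case unfolding \<iota>_submodule_def
  proof (intro conjI ballI allI)
    show "\<iota>_span (g # gs) \<subseteq> carrier R" using IH(1) g by auto
    have "\<zero> = \<iota> 0 \<otimes> g \<oplus> \<zero>" using g by (simp add: \<iota>_zero)
    then show "\<zero> \<in> \<iota>_span (g # gs)" using IH(2) by auto
  next
    fix x y assume "x \<in> \<iota>_span (g # gs)" "y \<in> \<iota>_span (g # gs)"
    then obtain p s q t where xy: "x = \<iota> p \<otimes> g \<oplus> s" "y = \<iota> q \<otimes> g \<oplus> t" and st: "s \<in> \<iota>_span gs" "t \<in> \<iota>_span gs"
      by auto
    then have c: "s \<in> carrier R" "t \<in> carrier R" using IH(1) by auto
    have "x \<oplus> y = \<iota> (p + q) \<otimes> g \<oplus> (s \<oplus> t)"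
      unfolding xy \<iota>_add using c g \<iota>_closed[of p] \<iota>_closed[of q] by algebra
    then show "x \<oplus> y \<in> \<iota>_span (g # gs)" using IH(3) st by auto
  next
    fix q x assume "x \<in> \<iota>_span (g # gs)"
    then obtain p s where x: "x = \<iota> p \<otimes> g \<oplus> s" and s: "s \<in> \<iota>_span gs" by auto
    then have c: "s \<in> carrier R" using IH(1) by auto
    have "\<iota> q \<otimes> x = \<iota> (q * p) \<otimes> g \<oplus> \<iota> q \<otimes> s"
      unfolding x \<iota>_mult using c g \<iota>_closed[of p] \<iota>_closed[of q] by algebra
    then show "\<iota> q \<otimes> x \<in> \<iota>_span (g # gs)" using IH(4) s by auto
  qed
qed

lemma generators_in_\<iota>_span:
  assumes "set gs \<subseteq> carrier R" "g \<in> set gs"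
  shows "g \<in> \<iota>_span gs"
  using assms
proof (induction gs)
  case (Cons h gs)
  have gs: "set gs \<subseteq> carrier R" and c: "g \<in> carrier R" "h \<in> carrier R" using Cons.prems by auto
  have "\<exists>p. \<exists>s\<in>\<iota>_span gs. g = \<iota> p \<otimes> h \<oplus> s"
  proof (cases "g = h")
    case True
    have "\<zero> \<in> \<iota>_span gs" using submodule_\<iota>_span[OF gs] by (simp add: \<iota>_submodule_def)
    moreover have "g = \<iota> 1 \<otimes> h \<oplus> \<zero>" using True c by (simp add: \<iota>_one)
    ultimately show ?thesis by blast
  next
    case False
    then have "g \<in> \<iota>_span gs" using Cons.IH[OF gs] Cons.prems by auto
    moreover have "g = \<iota> 0 \<otimes> h \<oplus> g" using c by (simp add: \<iota>_zero)
    ultimately show ?thesis by blast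
  qed
  then show ?case by auto
qed simp

text \<open>The usual argument over a principal ideal domain, by induction on the generators: the
  coefficients that elements of \<open>M\<close> have at the first generator form a principal ideal. Ideals
  \<open>I\<close> of the ring serve as the enclosing sets, since this is what the Noetherian property asks
  for.\<close>

lemma submodule_finitely_generated:
  assumes "set gs \<subseteq> carrier R" "\<iota>_submodule M" "M \<subseteq> \<iota>_span gs"
  shows "\<exists>A\<subseteq>M. finite A \<and> (\<forall>I. ideal I R \<and> A \<subseteq> I \<longrightarrow> M \<subseteq> I)"
  using assms
proof (induction gs arbitrary: M)
  case Nil
  then show ?case
    by (intro exI[of _ "{}"]) (auto dest!: ideal.axioms(1) additive_subgroup.zero_closed)
next
  case (Cons g gs)
  define S where "S = \<iota>_span gs"
  have S: "S \<subseteq> carrier R" "\<zero> \<in> S" "\<And>x y. x \<in> S \<Longrightarrow> y \<in> S \<Longrightarrow> x \<oplus> y \<in> S"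
    "\<And>p x. x \<in> S \<Longrightarrow> \<iota> p \<otimes> x \<in> S" and g: "g \<in> carrier R"
    using submodule_\<iota>_span[of gs] Cons.prems by (auto simp: \<iota>_submodule_def S_def)
  have M: "M \<subseteq> carrier R" "\<zero> \<in> M" "\<And>x y. x \<in> M \<Longrightarrow> y \<in> M \<Longrightarrow> x \<oplus> y \<in> M"
    "\<And>p x. x \<in> M \<Longrightarrow> \<iota> p \<otimes> x \<in> M"
    using Cons.prems by (auto simp: \<iota>_submodule_def)
  obtain f where f: "f \<in> {p. \<exists>s\<in>S. \<iota> p \<otimes> g \<oplus> s \<in> M}"
    "\<And>p. p \<in> {p. \<exists>s\<in>S. \<iota> p \<otimes> g \<oplus> s \<in> M} \<Longrightarrow> f dvd p"
  proof (rule poly_ideal_generator[of "{p. \<exists>s\<in>S. \<iota> p \<otimes> g \<oplus> s \<in> M}"])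
    show "0 \<in> {p. \<exists>s\<in>S. \<iota> p \<otimes> g \<oplus> s \<in> M}" using S(2) M(2) g by (force simp: \<iota>_zero)
  next
    fix p q assume "p \<in> {p. \<exists>s\<in>S. \<iota> p \<otimes> g \<oplus> s \<in> M}" "q \<in> {p. \<exists>s\<in>S. \<iota> p \<otimes> g \<oplus> s \<in> M}"
    then obtain s t where st: "s \<in> S" "t \<in> S" "\<iota> p \<otimes> g \<oplus> s \<in> M" "\<iota> q \<otimes> g \<oplus> t \<in> M" by auto
    have "\<iota> (p + q) \<otimes> g \<oplus> (s \<oplus> t) = (\<iota> p \<otimes> g \<oplus> s) \<oplus> (\<iota> q \<otimes> g \<oplus> t)"
      unfolding \<iota>_add using g \<iota>_closed[of p] \<iota>_closed[of q] subsetD[OF S(1) st(1)] subsetD[OF S(1) st(2)] by algebra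
    then show "p + q \<in> {p. \<exists>s\<in>S. \<iota> p \<otimes> g \<oplus> s \<in> M}" using st S(3) M(3) by (auto intro!: bexI[of _ "s \<oplus> t"])
  next
    fix p q assume "q \<in> {p. \<exists>s\<in>S. \<iota> p \<otimes> g \<oplus> s \<in> M}"
    then obtain s where st: "s \<in> S" "\<iota> q \<otimes> g \<oplus> s \<in> M" by auto
    have "\<iota> (p * q) \<otimes> g \<oplus> (\<iota> p \<otimes> s) = \<iota> p \<otimes> (\<iota> q \<otimes> g \<oplus> s)"
      unfolding \<iota>_mult using g \<iota>_closed[of p] \<iota>_closed[of q] subsetD[OF S(1) st(1)] by algebra
    then show "p * q \<in> {p. \<exists>s\<in>S. \<iota> p \<otimes> g \<oplus> s \<in> M}" using st S(4) M(4) by (auto intro!: bexI[of _ "\<iota> p \<otimes> s"])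
  qed (rule that)
  then obtain s0 where s0: "s0 \<in> S" "\<iota> f \<otimes> g \<oplus> s0 \<in> M" by auto
  define m0 where "m0 = \<iota> f \<otimes> g \<oplus> s0"
  have s0c: "s0 \<in> carrier R" using s0 S(1) by auto
  have "\<iota>_submodule (M \<inter> S)" using S M by (auto simp: \<iota>_submodule_def)
  then obtain A where A: "A \<subseteq> M \<inter> S" "finite A" "\<And>I. ideal I R \<Longrightarrow> A \<subseteq> I \<Longrightarrow> M \<inter> S \<subseteq> I"
    using Cons.IH[of "M \<inter> S"] Cons.prems(1) unfolding S_def by auto
  have "M \<subseteq> I" if I: "ideal I R" "insert m0 A \<subseteq> I" for I
  proof
    interpret ideal I R by fact
    fix x assume x: "x \<in> M"
    then have "x \<in> \<iota>_span (g # gs)" using Cons.prems by blast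
    then obtain p s where ps: "x = \<iota> p \<otimes> g \<oplus> s" "s \<in> S" by (auto simp: S_def)
    then have "f dvd p" using f(2) x by auto
    then obtain q where q: "p = f * q" by (rule dvdE)
    have sc: "s \<in> carrier R" using ps S(1) by auto
    have m0c: "m0 \<in> carrier R" using s0 M(1) by (auto simp: m0_def)
    have "x \<oplus> \<iota> (- q) \<otimes> m0 = s \<oplus> \<iota> (- q) \<otimes> s0"
      unfolding ps q m0_def \<iota>_mult \<iota>_uminus
      using g \<iota>_closed[of f] \<iota>_closed[of q] sc s0c by algebra
    moreover have "x \<oplus> \<iota> (- q) \<otimes> m0 \<in> M" using x M s0 by (simp add: m0_def)
    moreover have "s \<oplus> \<iota> (- q) \<otimes> s0 \<in> S" using ps s0 S by simp
    ultimately have "x \<oplus> \<iota> (- q) \<otimes> m0 \<in> I" using A(3)[OF I(1)] I(2) by auto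
    then have "(x \<oplus> \<iota> (- q) \<otimes> m0) \<oplus> \<iota> q \<otimes> m0 \<in> I" using I(2) I_l_closed by auto
    moreover have "(x \<oplus> \<iota> (- q) \<otimes> m0) \<oplus> \<iota> q \<otimes> m0 = x"
      unfolding \<iota>_uminus using subsetD[OF M(1) x] m0c \<iota>_closed[of q] by algebra
    ultimately show "x \<in> I" by simp
  qed
  then show ?case
    using A s0 by (intro exI[of _ "insert m0 A"]) (auto simp: m0_def)
qed

text \<open>At every maximal ideal depth and height are both one.\<close>

theorem cohen_macaulay_if_finite:
  assumes gs: "set gs \<subseteq> carrier R" "carrier R \<subseteq> \<iota>_span gs"
  shows "cohen_macaulay R"
  unfolding cohen_macaulay_def
proof (intro conjI allI impI)
  show "cring R" by (rule is_cring)
  show "noetherian_ring R"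
  proof (rule noetherian_ringI)
    fix I assume I: "ideal I R"
    interpret ideal I R by fact
    have "I \<subseteq> carrier R" using Icarr by blast
    then have "I \<subseteq> \<iota>_span gs" using gs(2) by (rule subset_trans)
    moreover have "\<iota>_submodule I" by (auto simp: \<iota>_submodule_def Icarr I_l_closed)
    ultimately obtain A where A: "A \<subseteq> I" "finite A" "\<And>J. ideal J R \<Longrightarrow> A \<subseteq> J \<Longrightarrow> I \<subseteq> J"
      using submodule_finitely_generated[OF gs(1)] by meson
    then have "I = Idl A"
      using genideal_minimal[OF I A(1)] genideal_ideal[of A] genideal_self[of A] \<open>I \<subseteq> carrier R\<close> by blast
    then show "\<exists>A\<subseteq>carrier R. finite A \<and> I = Idl A" using A \<open>I \<subseteq> carrier R\<close> by blast
  qed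
qed (simp add: ideal_depth_maximalideal prime_height_maximalideal)

end


section \<open>Monomials, weights and indispensability\<close>

abbreviation lookup where "lookup \<equiv> Poly_Mapping.lookup"
abbreviation single where "single \<equiv> Poly_Mapping.single"
abbreviation keys where "keys \<equiv> Poly_Mapping.keys"

lemma lookup_single_times:
  fixes p m :: "'a::cancel_comm_monoid_add" and f :: "'a \<Rightarrow>\<^sub>0 'b::comm_ring_1"
  shows "lookup (single p c * f) (p + m) = c * lookup f m"
  by (simp add: lookup_mult lookup_single when_mult)

lemma lookup_single_times_not_dvd:
  fixes p m :: "'a::cancel_comm_monoid_add" and f :: "'a \<Rightarrow>\<^sub>0 'b::comm_ring_1"
  assumes "\<nexists>t. m = p + t"
  shows "lookup (single p c * f) m = 0"
proof (rule ccontr)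
  assume "lookup (single p c * f) m \<noteq> 0"
  then have "m \<in> keys (single p c * f)" by (simp add: in_keys_iff)
  then show False using keys_mult[of "single p c" f] assms by (auto split: if_splits)
qed

lemma poly_mapping_sum_singles: "f = (\<Sum>m\<in>keys f. single m (lookup f m))"
  by (rule poly_mapping_eqI)
    (auto simp: lookup_sum lookup_single when_def in_keys_iff intro!: sum.neutral)

lemma mon_split:
  fixes p m :: mon
  assumes "\<And>i. lookup p i \<le> lookup m i"
  shows "m = p + (m - p)"
  by (rule poly_mapping_eqI) (simp add: lookup_add lookup_minus assms)

lemma mon_split_single:
  fixes m :: mon
  assumes "a \<le> lookup m i"
  shows "m = single i a + (m - single i a)"
  by (rule mon_split) (use assms in \<open>auto simp: lookup_single when_def\<close>)

lemma mon_eq_single: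
  fixes m :: mon
  assumes "keys m \<subseteq> {i}"
  shows "m = single i (lookup m i)"
  by (rule poly_mapping_eqI) (use assms in \<open>auto simp: lookup_single when_def in_keys_iff\<close>)

lemma keys_mon_add: "keys (p + q) = keys p \<union> keys q" for p q :: mon
  by (auto simp: in_keys_iff lookup_add)

lemma mdeg_add: "mdeg (p + q) = mdeg p + mdeg q"
  by (simp add: mdeg_def lookup_add sum.distrib)

lemma mdeg_single [simp]: "mdeg (single i a) = a"
  by (simp add: mdeg_def lookup_single when_def)

lemma mdeg_zero [simp]: "mdeg 0 = 0"
  by (simp add: mdeg_def)

definition weight :: "(xvar \<Rightarrow> nat) \<Rightarrow> mon \<Rightarrow> nat" where
  "weight n m = (\<Sum>i\<in>UNIV. lookup m i * n i)"

lemma weight_add: "weight n (p + q) = weight n p + weight n q"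
  by (simp add: weight_def lookup_add sum.distrib algebra_simps)

lemma weight_single [simp]: "weight n (single i a) = a * n i"
  by (simp add: weight_def lookup_single when_def if_distrib[of "\<lambda>x. x * _"] cong: if_cong)

lemma weight_zero [simp]: "weight n 0 = 0"
  by (simp add: weight_def)

lemma semigroup_of_iff_weight: "s \<in> semigroup_of n \<longleftrightarrow> (\<exists>m. weight n m = s)"
proof
  assume "s \<in> semigroup_of n"
  then obtain g where "s = (\<Sum>i\<in>UNIV. g i * n i)"
    by (auto simp: semigroup_of_def)
  then have "weight n (Abs_poly_mapping g) = s"
    by (simp add: weight_def)
  then show "\<exists>m. weight n m = s" ..
qed (auto simp: semigroup_of_def weight_def)

lemma xpow_eq_iff [simp]: "xpow p = (xpow q :: 'k::field mpoly4) \<longleftrightarrow> p = q"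
  by (metis xpow_def keys_single singleton_inject zero_neq_one)

lemma coeff_curve_hom:
  "Polynomial.coeff (curve_hom n f) s = (\<Sum>m | m \<in> keys f \<and> weight n m = s. lookup f m)"
  for f :: "'k::field mpoly4"
proof -
  have *: "(\<Prod>i\<in>UNIV. Polynomial.monom (1::'k) (n i) ^ lookup m i) = Polynomial.monom 1 (weight n m)" for m
  proof -
    have "(\<Prod>i\<in>A. Polynomial.monom (1::'k) (n i) ^ lookup m i)
        = Polynomial.monom 1 (\<Sum>i\<in>A. lookup m i * n i)" if "finite A" for A
      using that by induction (simp_all add: monom_power mult_monom mult.commute)
    then show ?thesis by (simp add: weight_def)
  qed
  have "Polynomial.coeff (curve_hom n f) s
      = (\<Sum>m\<in>keys f. if weight n m = s then lookup f m else 0)"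
    by (simp add: curve_hom_def * Polynomial.coeff_sum smult_monom if_distrib cong: if_cong)
  then show ?thesis
    by (simp add: sum.If_cases Int_def)
qed

text \<open>The curve ideal is graded by weight, and all monomials of weight \<open>s\<close> have the same image
  \<open>t^s\<close>.\<close>

lemma curve_ideal_iff:
  "f \<in> curve_ideal n \<longleftrightarrow> (\<forall>s. (\<Sum>m | m \<in> keys f \<and> weight n m = s. lookup f m) = 0)"
  for f :: "'k::field mpoly4"
  by (simp add: curve_ideal_def poly_eq_iff coeff_curve_hom)

lemma keys_binomial:
  "p \<noteq> q \<Longrightarrow> keys (xpow p - xpow q :: 'k::field mpoly4) = {p, q}"
  by (auto simp: in_keys_iff lookup_minus xpow_def lookup_single when_def split: if_splits)

lemma binomial_in_curve_ideal_iff: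
  "(xpow p - xpow q :: 'k::field mpoly4) \<in> curve_ideal n \<longleftrightarrow> weight n p = weight n q"
proof (cases "p = q")
  case True
  then show ?thesis by (simp add: curve_ideal_iff)
next
  case False
  let ?f = "xpow p - xpow q :: 'k mpoly4"
  have l: "lookup ?f p = 1" "lookup ?f q = -1"
    using False by (auto simp: lookup_minus xpow_def lookup_single)
  have *: "(\<Sum>m | m \<in> keys ?f \<and> weight n m = s. lookup ?f m)
      = (if weight n p = s then 1 else 0) - (if weight n q = s then 1 else 0)" for s
  proof -
    have "{m. m \<in> keys ?f \<and> weight n m = s} = {m \<in> {p, q}. weight n m = s}"
      by (simp add: keys_binomial[OF False])
    then have "(\<Sum>m | m \<in> keys ?f \<and> weight n m = s. lookup ?f m)
        = (\<Sum>m\<in>{p, q}. if weight n m = s then lookup ?f m else 0)"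
      by (simp add: sum.If_cases Int_def)
    then show ?thesis using False l by simp
  qed
  show ?thesis
  proof
    assume "?f \<in> curve_ideal n"
    then have "(\<Sum>m | m \<in> keys ?f \<and> weight n m = weight n p. lookup ?f m) = 0"
      by (simp add: curve_ideal_iff)
    then show "weight n p = weight n q" unfolding * by (auto split: if_splits)
  qed (simp add: curve_ideal_iff *)
qed

lemma mpoly4_ring_sel [simp]:
  "carrier (mpoly4_ring :: 'k::field mpoly4 ring) = UNIV"
  "monoid.mult (mpoly4_ring :: 'k::field mpoly4 ring) = (*)"
  "monoid.one (mpoly4_ring :: 'k::field mpoly4 ring) = 1"
  "ring.zero (mpoly4_ring :: 'k::field mpoly4 ring) = 0"
  "ring.add (mpoly4_ring :: 'k::field mpoly4 ring) = (+)"
  by (simp_all add: ring_of_type_algebra_def fun_eq_iff)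

lemma mpoly4_idealI:
  fixes I :: "'k::field mpoly4 set"
  assumes "0 \<in> I" "\<And>f g. f \<in> I \<Longrightarrow> g \<in> I \<Longrightarrow> f + g \<in> I" "\<And>f g. g \<in> I \<Longrightarrow> f * g \<in> I"
  shows "ideal I mpoly4_ring"
proof -
  interpret cring "mpoly4_ring :: 'k mpoly4 ring" by (rule cring_from_type_algebra)
  have inv: "inv\<^bsub>add_monoid mpoly4_ring\<^esub> f = - f" for f :: "'k mpoly4"
    using minus_equality[of "- f" f] by (simp add: a_inv_def)
  show ?thesis
  proof (rule idealI)
    show "subgroup I (add_monoid mpoly4_ring)"
      using assms(1,2) assms(3)[of _ "-1"] by (auto intro!: subgroup.intro simp: inv[simplified])
  qed (use assms(3) in \<open>auto simp: ring_axioms mult.commute\<close>)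
qed

text \<open>The polynomials all of whose multiples have coefficient \<open>0\<close> at \<open>q\<close> form an ideal. If no
  binomial of \<open>B\<close> has the term \<open>q\<close>, that ideal contains \<open>B\<close>: a multiple \<open>t t1 - t t2\<close> with
  \<open>t t1 = q\<close> would have its other term in the fibre of \<open>q\<close>, and it shares the factor \<open>t\<close> with
  \<open>q\<close>, so \<open>t = 1\<close> and \<open>t1 = q\<close>. But it does not contain \<open>q - p\<close>.\<close>

lemma indispensable_if_isolated:
  assumes iso: "\<And>m. weight n m = weight n q \<Longrightarrow> m \<noteq> q \<Longrightarrow> keys m \<inter> keys q = {}"
    and other: "weight n p = weight n q" "p \<noteq> q"
  shows "indispensable TYPE('k::field) n q"
  unfolding indispensable_def
proof (intro allI impI, elim conjE)
  fix B :: "'k mpoly4 set"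
  assume bin: "\<forall>f\<in>B. is_binomial f" and gen: "genideal mpoly4_ring B = curve_ideal n"
  interpret cring "mpoly4_ring :: 'k mpoly4 ring" by (rule cring_from_type_algebra)
  show "\<exists>f\<in>B. q \<in> keys f"
  proof (rule ccontr)
    assume none: "\<not> (\<exists>f\<in>B. q \<in> keys f)"
    define E where "E = {h :: 'k mpoly4. \<forall>g. lookup (g * h) q = 0}"
    have "ideal E mpoly4_ring"
      by (rule mpoly4_idealI) (auto simp: E_def distrib_left lookup_add simp flip: mult.assoc)
    moreover have "B \<subseteq> E"
    proof
      fix f assume f: "f \<in> B"
      with bin obtain t1 t2 where t: "t1 \<noteq> t2" "f = xpow t1 - xpow t2"
        by (auto simp: is_binomial_def)
      have qt: "q \<noteq> t1" "q \<noteq> t2" using none f keys_binomial[OF t(1)] t(2) by force+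
      have "f \<in> curve_ideal n" using gen genideal_self[of B] f by auto
      then have w: "weight n t1 = weight n t2" using t by (simp add: binomial_in_curve_ideal_iff)
      have nd: "\<nexists>t. q = t1 + t" if "q \<noteq> t1" "weight n t1 = weight n t2" "t1 \<noteq> t2" for t1 t2
      proof
        assume "\<exists>t. q = t1 + t"
        then obtain t where t: "q = t1 + t" ..
        then have "keys (t2 + t) \<inter> keys q = {}"
          using that t by (intro iso) (auto simp: weight_add)
        then have "keys t = {}" unfolding t keys_mon_add by blast
        then show False using t that by simp
      qed
      have "lookup (g * xpow t1) q = 0" "lookup (g * xpow t2) q = 0" for g :: "'k mpoly4"
        using lookup_single_times_not_dvd[OF nd[OF qt(1) w t(1)], of 1 g]
          lookup_single_times_not_dvd[OF nd[OF qt(2) w[symmetric] t(1)[symmetric]], of 1 g]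
        by (simp_all add: xpow_def mult.commute)
      then show "f \<in> E" by (simp add: E_def t right_diff_distrib lookup_minus)
    qed
    ultimately have "curve_ideal n \<subseteq> E" using gen genideal_minimal by blast
    moreover have "xpow p - xpow q \<in> (curve_ideal n :: 'k mpoly4 set)"
      using other by (simp add: binomial_in_curve_ideal_iff)
    ultimately have "lookup (1 * (xpow p - xpow q :: 'k mpoly4)) q = 0"
      unfolding E_def by blast
    then show False using other by (simp add: lookup_minus xpow_def lookup_single)
  qed
qed


section \<open>The tangent cone of a monomial curve\<close>

lemma finite_bounded_mons: "finite {m :: mon. \<forall>i. lookup m i \<le> b}"
proof -
  have "lookup ` {m :: mon. \<forall>i. lookup m i \<le> b} \<subseteq> (\<Pi>\<^sub>E i\<in>UNIV. {..b})" by auto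
  then have "finite (lookup ` {m :: mon. \<forall>i. lookup m i \<le> b})"
    by (rule finite_subset) (simp add: finite_PiE)
  then show ?thesis by (rule finite_imageD) (simp add: inj_on_def lookup_inject)
qed

locale positive_weights =
  fixes n :: "xvar \<Rightarrow> nat"
  assumes n_pos: "0 < n i"
begin

lemma lookup_le_weight: "lookup m i \<le> weight n m"
proof -
  have "lookup m i * 1 \<le> lookup m i * n i" using n_pos[of i] by (intro mult_le_mono2) simp
  also have "\<dots> \<le> weight n m" unfolding weight_def by (rule member_le_sum) auto
  finally show ?thesis by simp
qed

lemma finite_weight: "finite {m. weight n m = s}"
  by (rule finite_subset[OF _ finite_bounded_mons[of s]]) (auto simp: lookup_le_weight)

lemma weight_eq_0_iff [simp]: "weight n m = 0 \<longleftrightarrow> m = 0"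
  using n_pos by (auto simp: weight_def poly_mapping_eq_iff fun_eq_iff) (metis less_not_refl)

definition max_degree :: "nat \<Rightarrow> nat" where
  "max_degree s = Max (mdeg ` {m. weight n m = s})"

lemma mdeg_le_max_degree: "mdeg m \<le> max_degree (weight n m)"
  unfolding max_degree_def using finite_weight by (intro Max_ge) auto

lemma max_degree_attained:
  obtains m' where "weight n m' = weight n m" "mdeg m' = max_degree (weight n m)"
proof -
  have "Max (mdeg ` {m'. weight n m' = weight n m}) \<in> mdeg ` {m'. weight n m' = weight n m}"
    using finite_weight by (intro Max_in) auto
  then show ?thesis using that by (auto simp: max_degree_def)
qed

text \<open>The coordinate ring of the tangent cone has a basis indexed by the weights \<open>s\<close> that occur; this is
  the coordinate of \<open>f\<close> at \<open>s\<close>. Only monomials of maximal degree in their weight survive.\<close>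

definition cone_coeff :: "'k::field mpoly4 \<Rightarrow> nat \<Rightarrow> 'k" where
  "cone_coeff f s = (\<Sum>m | weight n m = s \<and> mdeg m = max_degree s. lookup f m)"

lemma cone_coeff_zero [simp]: "cone_coeff 0 s = 0"
  by (simp add: cone_coeff_def)

lemma cone_coeff_add: "cone_coeff (f + g) s = cone_coeff f s + cone_coeff g s"
  by (simp add: cone_coeff_def lookup_add sum.distrib)

lemma cone_coeff_sum: "cone_coeff (\<Sum>i\<in>A. f i) s = (\<Sum>i\<in>A. cone_coeff (f i) s)"
  by (induction A rule: infinite_finite_induct) (simp_all add: cone_coeff_add)

lemma cone_coeff_single_times_eq_sum:
  "cone_coeff (single p c * f) s
     = c * (\<Sum>m | weight n (p + m) = s \<and> mdeg (p + m) = max_degree s. lookup f m)"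
proof -
  let ?A = "{m. weight n m = s \<and> mdeg m = max_degree s}"
  let ?B = "{m. weight n (p + m) = s \<and> mdeg (p + m) = max_degree s}"
  have "finite ?A" by (rule finite_subset[OF _ finite_weight[of s]]) auto
  have "cone_coeff (single p c * f) s = (\<Sum>m\<in>(+) p ` ?B. lookup (single p c * f) m)"
    unfolding cone_coeff_def
    by (rule sum.mono_neutral_right[OF \<open>finite ?A\<close>])
      (auto intro!: lookup_single_times_not_dvd)
  also have "\<dots> = (\<Sum>m\<in>?B. c * lookup f m)"
    by (subst sum.reindex) (auto simp: inj_on_def lookup_single_times)
  finally show ?thesis by (simp add: sum_distrib_left)
qed

lemma cone_coeff_single_times:
  assumes "max_degree (s + weight n p) = max_degree s + mdeg p"
  shows "cone_coeff (single p c * f) (s + weight n p) = c * cone_coeff f s"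
proof -
  have "{m. weight n (p + m) = s + weight n p \<and> mdeg (p + m) = max_degree (s + weight n p)}
      = {m. weight n m = s \<and> mdeg m = max_degree s}"
    using assms by (auto simp: weight_add mdeg_add)
  then show ?thesis unfolding cone_coeff_single_times_eq_sum by (simp add: cone_coeff_def)
qed

text \<open>Multiplication by a monomial either kills the class of a weight in the tangent cone or
  shifts it: a top-degree monomial of weight \<open>t\<close> that is divisible by \<open>p\<close> is \<open>p\<close> times a
  top-degree monomial, and then the maximal degrees add.\<close>

lemma cone_coeff_single_times_cases:
  "cone_coeff (single p c * f) t = 0 \<or>
   (\<exists>s. t = s + weight n p \<and> cone_coeff (single p c * f) t = c * cone_coeff f s)"
proof (cases "\<exists>m. weight n (p + m) = t \<and> mdeg (p + m) = max_degree t")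
  case False
  then have "{m. weight n (p + m) = t \<and> mdeg (p + m) = max_degree t} = {}" by blast
  then have "cone_coeff (single p c * f) t = 0" by (simp only: cone_coeff_single_times_eq_sum) simp
  then show ?thesis ..
next
  case True
  then obtain m where m: "weight n (p + m) = t" "mdeg (p + m) = max_degree t" by blast
  obtain m' where m': "weight n m' = weight n m" "mdeg m' = max_degree (weight n m)"
    by (rule max_degree_attained)
  have "mdeg (p + m') \<le> max_degree t"
    using mdeg_le_max_degree[of "p + m'"] m m' by (simp add: weight_add)
  then have "max_degree (weight n m + weight n p) = max_degree (weight n m) + mdeg p"
    using m m' mdeg_le_max_degree[of m] by (simp add: mdeg_add weight_add add.commute)
  then show ?thesis
    using cone_coeff_single_times[of "weight n m" p c f] m by (auto simp: weight_add add.commute)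
qed

lemma cone_coeff_times_below:
  assumes "\<And>t. t < s \<Longrightarrow> cone_coeff f t = 0" "t < s"
  shows "cone_coeff (h * f) t = 0"
proof -
  have "h * f = (\<Sum>m\<in>keys h. single m (lookup h m) * f)"
    by (subst poly_mapping_sum_singles[of h]) (simp add: sum_distrib_right)
  moreover have "cone_coeff (single m c * f) t = 0" for m c
    using cone_coeff_single_times_cases[of m c f t] assms by auto
  ultimately show ?thesis by (simp add: cone_coeff_sum)
qed

definition cone_kernel :: "'k::field mpoly4 set" where
  "cone_kernel = {f. \<forall>s. cone_coeff f s = 0}"

lemma cone_kernel_ideal: "ideal cone_kernel (mpoly4_ring :: 'k::field mpoly4 ring)"
proof (rule mpoly4_idealI)
  fix f g :: "'k mpoly4" assume "g \<in> cone_kernel"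
  then show "f * g \<in> cone_kernel"
    using cone_coeff_times_below[of "Suc s" g s f for s] by (auto simp: cone_kernel_def)
qed (auto simp: cone_kernel_def cone_coeff_add)

lemma lookup_initial_form:
  "lookup (initial_form f) m = (if mdeg m = Min (mdeg ` keys f) then lookup f m else 0)"
proof -
  let ?S = "{m \<in> keys f. mdeg m = Min (mdeg ` keys f)}"
  have "lookup (initial_form f) m = (\<Sum>k\<in>?S. if k = m then lookup f k else 0)"
    by (simp only: initial_form_def lookup_sum lookup_single when_def)
  also have "\<dots> = (if m \<in> ?S then lookup f m else 0)" by (rule sum.delta) simp
  finally show ?thesis by (simp add: in_keys_iff)
qed

text \<open>Suppose the order of \<open>f\<close> is the maximal degree in weight \<open>s\<close>. Then every monomial of
  weight \<open>s\<close> in \<open>f\<close> has exactly this degree, and so the sum runs over the whole weight \<open>s\<close> part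
  of \<open>f\<close>, which adds up to zero. In the other weights the initial form has no monomial of
  maximal degree.\<close>

lemma initial_form_in_cone_kernel:
  assumes "f \<in> curve_ideal n"
  shows "initial_form f \<in> cone_kernel"
  unfolding cone_kernel_def
proof (intro CollectI allI)
  fix s
  let ?A = "{m. weight n m = s \<and> mdeg m = max_degree s}"
  show "cone_coeff (initial_form f) s = 0"
  proof (cases "max_degree s = Min (mdeg ` keys f)")
    case False
    then show ?thesis by (auto simp: cone_coeff_def lookup_initial_form intro!: sum.neutral)
  next
    case True
    have "finite ?A" by (rule finite_subset[OF _ finite_weight[of s]]) auto
    have "cone_coeff (initial_form f) s = (\<Sum>m\<in>?A. lookup f m)"
      unfolding cone_coeff_def using True by (intro sum.cong) (auto simp: lookup_initial_form)
    also have "\<dots> = (\<Sum>m | m \<in> keys f \<and> weight n m = s. lookup f m)"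
    proof (rule sum.mono_neutral_right[OF \<open>finite ?A\<close>])
      show "{m. m \<in> keys f \<and> weight n m = s} \<subseteq> ?A"
      proof (intro subsetI CollectI conjI)
        fix m assume m: "m \<in> {m. m \<in> keys f \<and> weight n m = s}"
        then have "Min (mdeg ` keys f) \<le> mdeg m" by (intro Min_le) auto
        moreover have "mdeg m \<le> max_degree s" using mdeg_le_max_degree[of m] m by blast
        ultimately show "mdeg m = max_degree s" unfolding True by (rule antisym[rotated])
      qed simp
    qed (auto simp: in_keys_iff)
    also have "\<dots> = 0" using assms by (simp add: curve_ideal_iff)
    finally show ?thesis .
  qed
qed

lemma lookup_xpow: "lookup (xpow p) m = (if m = p then 1 else 0)"
  by (auto simp: xpow_def lookup_single)

lemma lookup_initial_form_binomial:
  assumes "mdeg p \<le> mdeg q" "p \<noteq> q"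
  shows "lookup (initial_form (xpow p - xpow q :: 'k::field mpoly4)) m
    = (if mdeg m = mdeg p then lookup (xpow p) m - lookup (xpow q) m else 0)"
  using assms(1) by (simp add: lookup_initial_form keys_binomial[OF assms(2)] lookup_minus)

lemma initial_form_binomial_less:
  assumes "mdeg p < mdeg q"
  shows "initial_form (xpow p - xpow q :: 'k::field mpoly4) = xpow p"
proof (rule poly_mapping_eqI)
  fix m
  have "p \<noteq> q" using assms by auto
  then show "lookup (initial_form (xpow p - xpow q :: 'k mpoly4)) m = lookup (xpow p) m"
    using assms by (cases "m = q"; cases "m = p")
      (simp_all add: lookup_initial_form_binomial lookup_xpow)
qed

lemma initial_form_binomial_eq:
  assumes "mdeg p = mdeg q"
  shows "initial_form (xpow p - xpow q :: 'k::field mpoly4) = xpow p - xpow q"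
proof (cases "p = q")
  case False
  show ?thesis
  proof (rule poly_mapping_eqI)
    fix m
    show "lookup (initial_form (xpow p - xpow q :: 'k mpoly4)) m = lookup (xpow p - xpow q) m"
      using assms False by (cases "m = q"; cases "m = p")
        (simp_all add: lookup_initial_form_binomial lookup_minus lookup_xpow)
  qed
qed (simp add: initial_form_def)

text \<open>Modulo initial forms of binomials, a monomial that does not have maximal degree in its
  weight is zero, and monomials of maximal degree agree with a chosen representative \<open>rep\<close> of
  their weight. So every \<open>f\<close> reduces to a combination of the representatives, whose coefficients
  are the numbers \<open>cone_coeff f s\<close>.\<close>

lemma initial_ideal_curve_ideal:
  "initial_ideal (curve_ideal n) = (cone_kernel :: 'k::field mpoly4 set)"
proof
  interpret cring "mpoly4_ring :: 'k mpoly4 ring" by (rule cring_from_type_algebra)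
  show "initial_ideal (curve_ideal n) \<subseteq> (cone_kernel :: 'k mpoly4 set)"
    unfolding initial_ideal_def
    using initial_form_in_cone_kernel by (intro genideal_minimal cone_kernel_ideal) auto
  let ?J = "initial_ideal (curve_ideal n) :: 'k mpoly4 set"
  interpret J: ideal ?J mpoly4_ring
    unfolding initial_ideal_def by (rule genideal_ideal) simp
  have gen: "initial_form f \<in> ?J" if "f \<in> curve_ideal n" for f
    unfolding initial_ideal_def using that by (intro subsetD[OF genideal_self]) auto
  have J_add: "f + g \<in> ?J" if "f \<in> ?J" "g \<in> ?J" for f g
    using J.a_closed that by simp
  have J_mult: "h * f \<in> ?J" if "f \<in> ?J" for f h
    using J.I_l_closed that by simp
  have J_sum: "(\<Sum>i\<in>A. f i) \<in> ?J" if "\<And>i. i \<in> A \<Longrightarrow> f i \<in> ?J" for A and f :: "mon \<Rightarrow> 'k mpoly4"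
    using that by (induction A rule: infinite_finite_induct) (use J.zero_closed in \<open>auto intro: J_add\<close>)
  define rep where "rep s = (SOME m. weight n m = s \<and> mdeg m = max_degree s)" for s
  have rep: "weight n (rep (weight n m)) = weight n m" "mdeg (rep (weight n m)) = max_degree (weight n m)" for m
  proof -
    have "\<exists>m'. weight n m' = weight n m \<and> mdeg m' = max_degree (weight n m)"
      using max_degree_attained by blast
    from someI_ex[OF this]
    show "weight n (rep (weight n m)) = weight n m" "mdeg (rep (weight n m)) = max_degree (weight n m)"
      by (auto simp: rep_def)
  qed
  define red where "red m = (if mdeg m = max_degree (weight n m) then xpow (rep (weight n m)) else 0 :: 'k mpoly4)" for m
  have red: "xpow m - red m \<in> ?J" for m
  proof -
    have I: "(xpow m - xpow (rep (weight n m)) :: 'k mpoly4) \<in> curve_ideal n"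
      by (simp add: binomial_in_curve_ideal_iff rep)
    show ?thesis
    proof (cases "mdeg m = max_degree (weight n m)")
      case True
      then show ?thesis using gen[OF I] by (simp add: red_def initial_form_binomial_eq rep)
    next
      case False
      then have "mdeg m < mdeg (rep (weight n m))" using mdeg_le_max_degree[of m] rep by simp
      then show ?thesis using gen[OF I] False by (simp add: red_def initial_form_binomial_less)
    qed
  qed
  show "cone_kernel \<subseteq> ?J"
  proof
    fix f :: "'k mpoly4" assume f: "f \<in> cone_kernel"
    have "(\<Sum>m\<in>keys f. single 0 (lookup f m) * red m) = 0"
    proof (rule poly_mapping_eqI)
      fix t
      have l: "lookup (single 0 (lookup f m) * red m) t
          = (if mdeg m = max_degree (weight n m) \<and> rep (weight n m) = t then lookup f m else 0)" for m
        using lookup_single_times[of 0 "lookup f m" "red m" t]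
        by (auto simp: red_def xpow_def lookup_single when_def)
      show "lookup (\<Sum>m\<in>keys f. single 0 (lookup f m) * red m) t = lookup 0 t"
      proof (cases "rep (weight n t) = t")
        case True
        have eq: "mdeg m = max_degree (weight n m) \<and> rep (weight n m) = t
          \<longleftrightarrow> weight n m = weight n t \<and> mdeg m = max_degree (weight n t)" for m
          using True rep(1)[of m] by auto
        let ?A = "{m. weight n m = weight n t \<and> mdeg m = max_degree (weight n t)}"
        have "finite ?A" by (rule finite_subset[OF _ finite_weight[of "weight n t"]]) auto
        have "lookup (\<Sum>m\<in>keys f. single 0 (lookup f m) * red m) t
          = (\<Sum>m\<in>keys f \<inter> ?A. lookup f m)"
          by (simp add: lookup_sum l eq sum.If_cases Int_def)
        also have "\<dots> = cone_coeff f (weight n t)"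
          unfolding cone_coeff_def
          by (rule sum.mono_neutral_left[OF \<open>finite ?A\<close>]) (auto simp: in_keys_iff)
        finally show ?thesis using f by (simp add: cone_kernel_def)
      next
        case False
        then have "rep (weight n m) \<noteq> t" for m using rep(1)[of m] by auto
        then show ?thesis by (simp add: lookup_sum l)
      qed
    qed
    then have "f = (\<Sum>m\<in>keys f. single 0 (lookup f m) * (xpow m - red m))"
      using poly_mapping_sum_singles[of f]
      by (simp add: right_diff_distrib sum_subtractf xpow_def mult_single)
    also have "\<dots> \<in> ?J" by (intro J_sum J_mult red)
    finally show "f \<in> ?J" .
  qed
qed

end

definition poly_in_x1 :: "'k::field poly \<Rightarrow> 'k mpoly4" where
  "poly_in_x1 p = fold_coeffs (\<lambda>a f. single 0 a + xpow (single X1 1) * f) p 0"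

lemma poly_in_x1_0 [simp]: "poly_in_x1 0 = 0"
  by (simp add: poly_in_x1_def)

lemma poly_in_x1_pCons: "poly_in_x1 (pCons a p) = single 0 a + xpow (single X1 1) * poly_in_x1 p"
  by (cases "p = 0 \<and> a = 0") (auto simp: poly_in_x1_def)

lemma poly_in_x1_add: "poly_in_x1 (p + q) = poly_in_x1 p + poly_in_x1 q"
  by (induction p q rule: poly_induct2) (simp_all add: poly_in_x1_pCons single_add algebra_simps)

lemma poly_in_x1_smult: "poly_in_x1 (Polynomial.smult a p) = single 0 a * poly_in_x1 p"
  by (induction p) (simp_all add: poly_in_x1_pCons mult_single algebra_simps)

lemma poly_in_x1_mult: "poly_in_x1 (p * q) = poly_in_x1 p * poly_in_x1 q"
  by (induction p) (simp_all add: poly_in_x1_pCons poly_in_x1_add poly_in_x1_smult algebra_simps)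

lemma poly_in_x1_1: "poly_in_x1 1 = 1"
  by (simp add: one_pCons poly_in_x1_pCons)

lemma poly_in_x1_monom: "poly_in_x1 (Polynomial.monom c k) = single (single X1 k) c"
  by (induction k)
    (simp_all add: monom_0 monom_Suc poly_in_x1_pCons xpow_def mult_single flip: single_add)

lemma xpow_add: "xpow (p + q) = xpow p * xpow q"
  by (simp add: xpow_def mult_single)

lemma xpow_single_power: "xpow (single i k) = (xpow (single i 1) ^ k :: 'k::field mpoly4)"
proof (induction k)
  case (Suc k)
  have "xpow (single i (Suc k)) = (xpow (single i 1 + single i k) :: 'k mpoly4)" by (simp flip: single_add)
  then show ?case using Suc by (simp add: xpow_add)
qed (simp add: xpow_def)

locale numerical_weights = positive_weights +
  assumes n_X1_less: "i \<noteq> X1 \<Longrightarrow> n X1 < n i"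
begin

text \<open>The monomials \<open>x\<^sub>i^n\<^sub>1\<close> and \<open>x\<^sub>1^n\<^sub>i\<close> have the same weight, and the second has the larger
  degree.\<close>

lemma xpow_n_X1_in_cone_kernel:
  assumes "i \<noteq> X1"
  shows "xpow (single i (n X1)) \<in> cone_kernel"
proof -
  have "n i = mdeg (single X1 (n i))" by simp
  also have "\<dots> \<le> max_degree (n X1 * n i)"
    using mdeg_le_max_degree[of "single X1 (n i)"] by (simp add: mult.commute)
  finally have "n X1 \<noteq> max_degree (n X1 * n i)" using n_X1_less[OF assms] by simp
  then show ?thesis
    by (auto simp: cone_kernel_def cone_coeff_def xpow_def lookup_single when_def intro!: sum.neutral)
qed

lemma one_notin_cone_kernel: "(1 :: 'k::field mpoly4) \<notin> cone_kernel"
proof -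
  have "max_degree 0 = 0" using max_degree_attained[of 0] by auto
  then have "{m. weight n m = 0 \<and> mdeg m = max_degree 0} = {0}" by auto
  then have "cone_coeff (1 :: 'k mpoly4) 0 = 1" by (simp add: cone_coeff_def)
  then show ?thesis unfolding cone_kernel_def by (auto intro!: exI[of _ 0])
qed

text \<open>The degree condition says that multiplication by \<open>x\<^sub>1\<close> is injective on the tangent cone.
  Grading by weight extends this to all nonzero polynomials in \<open>x\<^sub>1\<close>, so the coordinate ring is a
  torsion-free, finite thickening of the line.\<close>

theorem cm_tangent_coneI:
  assumes max_degree_plus: "\<And>m. max_degree (weight n m + n X1) = max_degree (weight n m) + 1"
  shows "cm_tangent_cone TYPE('k::field) n"
proof -
  let ?A = "mpoly4_ring :: 'k mpoly4 ring"
  let ?J = "cone_kernel :: 'k mpoly4 set"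
  interpret A: cring ?A by (rule cring_from_type_algebra)
  interpret J: ideal ?J ?A by (rule cone_kernel_ideal)
  have J_mult: "h * f \<in> ?J" if "f \<in> ?J" for f h
    using J.I_l_closed that by simp

  have x1: "f \<in> ?J" if "xpow (single X1 1) * f \<in> ?J" for f
  proof -
    have "cone_coeff f s = 0" for s
    proof (cases "\<exists>m. weight n m = s")
      case True
      then obtain m where m: "weight n m = s" ..
      have "cone_coeff (xpow (single X1 1) * f) (s + n X1) = cone_coeff f s"
        using cone_coeff_single_times[of s "single X1 1" 1 f] max_degree_plus[of m] m
        by (simp add: xpow_def)
      then show ?thesis using that by (simp add: cone_kernel_def)
    qed (simp add: cone_coeff_def)
    then show ?thesis by (simp add: cone_kernel_def)
  qed
  have tf: "f \<in> ?J" if "poly_in_x1 p * f \<in> ?J" "p \<noteq> 0" for p f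
    using that
  proof (induction p)
    case (pCons a p)
    have eq: "poly_in_x1 (pCons a p) * f = single 0 a * f + xpow (single X1 1) * (poly_in_x1 p * f)"
      by (simp add: poly_in_x1_pCons algebra_simps)
    show ?case
    proof (cases "a = 0")
      case True
      then have "poly_in_x1 p * f \<in> ?J" "p \<noteq> 0" using pCons.prems eq x1 by auto
      then show ?thesis by (rule pCons.IH)
    next
      case False
      show ?thesis
      proof (rule ccontr)
        assume "f \<notin> ?J"
        \<comment> \<open>In the lowest weight \<open>s\<close> where \<open>f\<close> is nonzero, only the constant term \<open>a\<close> contributes.\<close>
        then obtain s where s: "cone_coeff f s \<noteq> 0" "\<And>t. t < s \<Longrightarrow> cone_coeff f t = 0"
          using exists_least_iff[of "\<lambda>s. cone_coeff f s \<noteq> 0"] by (auto simp: cone_kernel_def)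
        have "cone_coeff (xpow (single X1 1) * (poly_in_x1 p * f)) s = 0"
        proof -
          have "cone_coeff (poly_in_x1 p * f) t = 0" if "s = t + n X1" for t
            using cone_coeff_times_below[of s f t] s(2) that n_pos[of X1] by simp
          then show ?thesis
            using cone_coeff_single_times_cases[of "single X1 1" 1 "poly_in_x1 p * f" s]
            by (auto simp: xpow_def)
        qed
        moreover have "cone_coeff (single 0 a * f) s = a * cone_coeff f s"
          by (simp add: cone_coeff_single_times_eq_sum) (simp add: cone_coeff_def)
        ultimately have "cone_coeff (poly_in_x1 (pCons a p) * f) s = a * cone_coeff f s"
          by (simp add: eq cone_coeff_add)
        then show False using pCons.prems s False by (simp add: cone_kernel_def)
      qed
    qed
  qed simp

  define Q where "Q = ?A Quot ?J"
  define \<pi> where "\<pi> f = ?J +>\<^bsub>?A\<^esub> f" for f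
  have Q_cring: "cring Q" unfolding Q_def by (rule J.quotient_is_cring) (rule A.is_cring)
  have hom: "\<pi> \<in> ring_hom ?A Q"
    unfolding \<pi>_def Q_def using J.rcos_ring_hom by (simp add: fun_eq_iff)
  have \<pi>_closed: "\<pi> f \<in> carrier Q" and \<pi>_add: "\<pi> (f + g) = \<pi> f \<oplus>\<^bsub>Q\<^esub> \<pi> g"
    and \<pi>_mult: "\<pi> (f * g) = \<pi> f \<otimes>\<^bsub>Q\<^esub> \<pi> g" and \<pi>_one: "\<pi> 1 = \<one>\<^bsub>Q\<^esub>" for f g
    using ring_hom_closed[OF hom] ring_hom_add[OF hom] ring_hom_mult[OF hom] ring_hom_one[OF hom] by auto
  have \<pi>_surj: "\<exists>f. r = \<pi> f" if "r \<in> carrier Q" for r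
    using that by (auto simp: Q_def \<pi>_def FactRing_def A_RCOSETS_def')
  have \<pi>_zero_iff: "\<pi> f = \<zero>\<^bsub>Q\<^esub> \<longleftrightarrow> f \<in> ?J" for f
    using A.a_rcos_zero[OF J.is_ideal] J.rcos_const_imp_mem[of f] by (auto simp: Q_def \<pi>_def FactRing_def)
  interpret Q: cring Q by (rule Q_cring)
  have \<pi>_pow: "\<pi> (f ^ k) = \<pi> f [^]\<^bsub>Q\<^esub> k" for f k
    by (induction k) (simp_all add: \<pi>_one \<pi>_mult \<pi>_closed Q.m_comm)
  have nil: "Q.nilpotent (\<pi> (single m c))" if "i \<noteq> X1" "i \<in> keys m" for i m c
  proof -
    have "m = single i 1 + (m - single i 1)"
      using that(2) by (intro mon_split_single) (simp add: in_keys_iff)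
    then have "single m c = single (m - single i 1) c * xpow (single i 1)"
      by (simp add: xpow_def mult_single add.commute)
    moreover have "\<pi> (xpow (single i 1)) [^]\<^bsub>Q\<^esub> n X1 = \<zero>\<^bsub>Q\<^esub>"
      using xpow_n_X1_in_cone_kernel[OF that(1)]
      by (simp only: \<pi>_pow[symmetric] xpow_single_power[symmetric] \<pi>_zero_iff)
    then have "Q.nilpotent (\<pi> (xpow (single i 1)))" using \<pi>_closed by (auto simp: Q.nilpotent_def)
    ultimately show ?thesis by (simp add: \<pi>_mult \<pi>_closed Q.nilpotent_mult)
  qed
  have \<pi>_poly_zero: "\<pi> (poly_in_x1 0) = \<zero>\<^bsub>Q\<^esub>" using J.zero_closed by (simp add: \<pi>_zero_iff)

  interpret line_thickening Q "\<lambda>p. \<pi> (poly_in_x1 p)"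
  proof unfold_locales
    show "\<one>\<^bsub>Q\<^esub> \<noteq> \<zero>\<^bsub>Q\<^esub>" using one_notin_cone_kernel \<pi>_zero_iff by (simp flip: \<pi>_one)
  next
    fix y p assume "y \<in> carrier Q" "p \<noteq> 0" and 0: "\<pi> (poly_in_x1 p) \<otimes>\<^bsub>Q\<^esub> y = \<zero>\<^bsub>Q\<^esub>"
    then obtain f where f: "y = \<pi> f" using \<pi>_surj by blast
    then show "y = \<zero>\<^bsub>Q\<^esub>" using 0 tf[of p f] \<open>p \<noteq> 0\<close> by (simp add: \<pi>_zero_iff flip: \<pi>_mult)
  next
    fix r assume "r \<in> carrier Q"
    then obtain f where r: "r = \<pi> f" using \<pi>_surj by blast
    have "\<exists>p. Q.nilpotent (\<pi> (\<Sum>m\<in>M. single m (lookup f m)) \<ominus>\<^bsub>Q\<^esub> \<pi> (poly_in_x1 p))" if "finite M" for M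
      using that
    proof (induction M)
      case empty
      have "Q.nilpotent \<zero>\<^bsub>Q\<^esub>" unfolding Q.nilpotent_def by (auto intro: exI[of _ "1::nat"])
      then show ?case using \<pi>_poly_zero by (intro exI[of _ 0]) (simp add: Q.minus_eq)
    next
      case (insert m M)
      let ?g = "\<Sum>m\<in>M. single m (lookup f m)"
      obtain p where p: "Q.nilpotent (\<pi> ?g \<ominus>\<^bsub>Q\<^esub> \<pi> (poly_in_x1 p))" using insert.IH by blast
      obtain q where q: "Q.nilpotent (\<pi> (single m (lookup f m)) \<ominus>\<^bsub>Q\<^esub> \<pi> (poly_in_x1 q))"
      proof (cases "keys m \<subseteq> {X1}")
        case True
        then have "poly_in_x1 (Polynomial.monom (lookup f m) (lookup m X1)) = single m (lookup f m)"
          using mon_eq_single by (metis poly_in_x1_monom)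
        moreover have "Q.nilpotent \<zero>\<^bsub>Q\<^esub>" unfolding Q.nilpotent_def by (auto intro: exI[of _ "1::nat"])
        ultimately show ?thesis
          using that[of "Polynomial.monom (lookup f m) (lookup m X1)"] \<pi>_closed by (simp add: Q.minus_eq Q.r_neg)
      next
        case False
        then obtain i where "i \<in> keys m" "i \<noteq> X1" by blast
        then have "Q.nilpotent (\<pi> (single m (lookup f m)))" using nil by blast
        then show ?thesis using that[of 0] \<pi>_poly_zero \<pi>_closed by (simp add: Q.minus_eq)
      qed
      have alg: "(a \<oplus>\<^bsub>Q\<^esub> b) \<ominus>\<^bsub>Q\<^esub> (c \<oplus>\<^bsub>Q\<^esub> d) = (a \<ominus>\<^bsub>Q\<^esub> c) \<oplus>\<^bsub>Q\<^esub> (b \<ominus>\<^bsub>Q\<^esub> d)"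
        if "a \<in> carrier Q" "b \<in> carrier Q" "c \<in> carrier Q" "d \<in> carrier Q" for a b c d
        using that by algebra
      have "Q.nilpotent (\<pi> (single m (lookup f m) + ?g) \<ominus>\<^bsub>Q\<^esub> \<pi> (poly_in_x1 (q + p)))"
        unfolding \<pi>_add poly_in_x1_add by (subst alg) (use \<pi>_closed p q in \<open>auto intro: Q.nilpotent_add\<close>)
      then show ?case using insert.hyps by auto
    qed
    then show "\<exists>p. Q.nilpotent (r \<ominus>\<^bsub>Q\<^esub> \<pi> (poly_in_x1 p))"
      using poly_mapping_sum_singles[of f] r by (metis finite_keys)
  qed (auto simp: \<pi>_closed \<pi>_add \<pi>_mult \<pi>_one poly_in_x1_add poly_in_x1_mult poly_in_x1_1)

  \<comment> \<open>Higher powers of \<open>x\<^sub>2, x\<^sub>3, x\<^sub>4\<close> vanish, and powers of \<open>x\<^sub>1\<close> are scalars, so these monomials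
    generate the ring over \<open>K[x\<^sub>1]\<close>.\<close>
  obtain ms where ms: "set ms = {m :: mon. \<forall>i. lookup m i \<le> n X1}"
    using finite_list[OF finite_bounded_mons] by blast
  let ?gs = "map (\<lambda>m. \<pi> (xpow m)) ms"
  have "\<iota>_submodule (\<iota>_span ?gs)" by (rule submodule_\<iota>_span) (auto simp: \<pi>_closed)
  then have span: "\<zero>\<^bsub>Q\<^esub> \<in> \<iota>_span ?gs" "\<And>x y. x \<in> \<iota>_span ?gs \<Longrightarrow> y \<in> \<iota>_span ?gs \<Longrightarrow> x \<oplus>\<^bsub>Q\<^esub> y \<in> \<iota>_span ?gs"
    "\<And>p x. x \<in> \<iota>_span ?gs \<Longrightarrow> \<pi> (poly_in_x1 p) \<otimes>\<^bsub>Q\<^esub> x \<in> \<iota>_span ?gs"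
    by (auto simp: \<iota>_submodule_def)
  have mono: "\<pi> (single m c) \<in> \<iota>_span ?gs" for m c
  proof -
    define m' where "m' = m - single X1 (lookup m X1)"
    have m: "m = single X1 (lookup m X1) + m'" unfolding m'_def by (rule mon_split_single) simp
    have m'X1: "lookup m' X1 = 0" by (simp add: m'_def lookup_minus)
    have "\<pi> (xpow m') \<in> \<iota>_span ?gs"
    proof (cases "\<forall>i. lookup m' i \<le> n X1")
      case True
      then show ?thesis using ms by (intro generators_in_\<iota>_span) (auto simp: \<pi>_closed)
    next
      case False
      then obtain i where i: "n X1 \<le> lookup m' i" "i \<noteq> X1" using m'X1 by (metis le_cases not_less_zero zero_le)
      have "(xpow m' :: 'k mpoly4) = xpow (m' - single i (n X1)) * xpow (single i (n X1))"
        using mon_split_single[OF i(1)] by (metis xpow_add add.commute)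
      then have "xpow m' \<in> ?J" using J_mult xpow_n_X1_in_cone_kernel[OF i(2)] by simp
      then show ?thesis using span(1) by (simp flip: \<pi>_zero_iff)
    qed
    moreover have "single m c = poly_in_x1 (Polynomial.monom c (lookup m X1)) * xpow m'"
      by (subst m) (simp add: poly_in_x1_monom xpow_def mult_single)
    ultimately show ?thesis using span(3) by (simp add: \<pi>_mult)
  qed
  have sum: "\<pi> (\<Sum>m\<in>M. single m (lookup f m)) \<in> \<iota>_span ?gs" if "finite M" for M f
    using that by (induction M) (use span mono \<pi>_poly_zero in \<open>auto simp: \<pi>_add\<close>)
  have "\<pi> f \<in> \<iota>_span ?gs" for f
    by (subst poly_mapping_sum_singles[of f]) (rule sum[OF finite_keys])
  then have "carrier Q \<subseteq> \<iota>_span ?gs" using \<pi>_surj by blast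
  then have "cohen_macaulay Q" by (intro cohen_macaulay_if_finite[of ?gs]) (auto simp: \<pi>_closed)
  then show ?thesis by (simp add: cm_tangent_cone_def initial_ideal_curve_ideal Q_def)
qed

end


section \<open>Monomials divisible by the first variable\<close>

lemma crit_exp_le:
  assumes "0 < a" "weight n m = a * n i" "i \<notin> keys m"
  shows "crit_exp n i \<le> a"
proof -
  have "weight n m = (\<Sum>j\<in>UNIV - {i}. lookup m j * n j)"
    using assms(3) by (simp add: weight_def in_keys_iff sum.remove[of UNIV i])
  then show ?thesis
    unfolding crit_exp_def using assms by (intro Least_le) (auto intro!: exI[of _ "lookup m"])
qed

lemma crit_exp_pos:
  assumes "0 < n j" "j \<noteq> i"
  shows "0 < crit_exp n i"
proof -
  have "(\<Sum>l\<in>UNIV - {i}. (if l = j then n i else 0) * n l)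
      = (\<Sum>l\<in>UNIV - {i}. if l = j then n j * n i else 0)"
    by (rule sum.cong) auto
  also have "\<dots> = n j * n i" using assms(2) by simp
  finally have "n j * n i = (\<Sum>l\<in>UNIV - {i}. (if l = j then n i else 0) * n l)" by (rule sym)
  then have "\<exists>a. a > 0 \<and> (\<exists>g :: xvar \<Rightarrow> nat. a * n i = (\<Sum>l\<in>UNIV - {i}. g l * n l))"
    using assms(1) by (intro exI[of _ "n j"] conjI exI[of _ "\<lambda>l. if l = j then n i else 0"])
  then show ?thesis unfolding crit_exp_def by (rule LeastI2_ex) blast
qed

lemma critical_binomialD:
  assumes "critical_binomial n i (crit_diff n i t :: 'k::field mpoly4)"
  shows "weight n t = crit_exp n i * n i" "i \<notin> keys t"
  using assms by (auto simp: critical_binomial_def crit_diff_def binomial_in_curve_ideal_iff)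

lemma weight_mon234: "weight n (mon234 a b c) = a * n X2 + b * n X3 + c * n X4"
  by (simp add: mon234_def weight_add)

lemma mon_eq_mon234:
  assumes "X1 \<notin> keys m"
  shows "m = mon234 (lookup m X2) (lookup m X3) (lookup m X4)"
proof (rule poly_mapping_eqI)
  fix i
  show "lookup m i = lookup (mon234 (lookup m X2) (lookup m X3) (lookup m X4)) i"
    using assms by (cases i) (simp_all add: mon234_def lookup_add lookup_single in_keys_iff)
qed

lemma indisp_binomialsI:
  assumes "{i1, i2, i3, i4} = UNIV" "0 < u1" "u1 < crit_exp n i1" "0 < u2" "u2 < crit_exp n i2"
    and "0 < u3" "0 < u4" "p = single i1 u1 + single i2 u2" "q = single i3 u3 + single i4 u4"
    and "indispensable TYPE('k::field) n q" "weight n p = weight n q"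
  shows "(xpow p - xpow q :: 'k mpoly4) \<in> indisp_binomials n"
proof -
  have "(xpow p - xpow q :: 'k mpoly4) \<in> curve_ideal n"
    using assms(11) by (simp only: binomial_in_curve_ideal_iff)
  with assms(1-10) show ?thesis unfolding indisp_binomials_def by blast
qed

context numerical_weights
begin

definition has_x1_mate :: "mon \<Rightarrow> bool" where
  "has_x1_mate m \<longleftrightarrow> (\<exists>p. X1 \<in> keys p \<and> weight n p = weight n m)"

definition has_long_x1_mate :: "mon \<Rightarrow> bool" where
  "has_long_x1_mate m \<longleftrightarrow> (\<exists>p. X1 \<in> keys p \<and> weight n p = weight n m \<and> mdeg m \<le> mdeg p)"

lemma has_x1_mate_iff: "has_x1_mate m \<longleftrightarrow> weight n m \<in> (\<lambda>s. n X1 + s) ` semigroup_of n"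
proof
  assume "has_x1_mate m"
  then obtain p where p: "X1 \<in> keys p" "weight n p = weight n m" by (auto simp: has_x1_mate_def)
  then have "p = single X1 1 + (p - single X1 1)" by (intro mon_split_single) (simp add: in_keys_iff)
  then have "weight n p = weight n (single X1 1 + (p - single X1 1))" by (rule arg_cong)
  then have "weight n m = n X1 + weight n (p - single X1 1)"
    using p by (simp add: weight_add)
  then show "weight n m \<in> (\<lambda>s. n X1 + s) ` semigroup_of n"
    by (rule image_eqI) (auto simp: semigroup_of_iff_weight)
next
  assume "weight n m \<in> (\<lambda>s. n X1 + s) ` semigroup_of n"
  then obtain q where "weight n m = n X1 + weight n q" by (auto simp: semigroup_of_iff_weight)
  then show "has_x1_mate m"
    by (auto simp: has_x1_mate_def keys_mon_add weight_add intro!: exI[of _ "single X1 1 + q"])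
qed

lemma liftable_iff:
  "liftable TYPE('k::field) n a b c
     \<longleftrightarrow> (has_x1_mate (mon234 a b c) \<longrightarrow> has_long_x1_mate (mon234 a b c))"
  unfolding liftable_def has_x1_mate_iff has_long_x1_mate_def weight_mon234
  by (auto simp: binomial_in_curve_ideal_iff weight_mon234)

lemma has_long_x1_mateI_divisible: "X1 \<in> keys m \<Longrightarrow> has_long_x1_mate m"
  by (auto simp: has_long_x1_mate_def)

lemma has_long_x1_mate_add: "has_long_x1_mate m \<Longrightarrow> has_long_x1_mate (q + m)"
  unfolding has_long_x1_mate_def
proof (elim exE conjE)
  fix p assume "X1 \<in> keys p" "weight n p = weight n m" "mdeg m \<le> mdeg p"
  then show "\<exists>p. X1 \<in> keys p \<and> weight n p = weight n (q + m) \<and> mdeg (q + m) \<le> mdeg p"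
    by (intro exI[of _ "q + p"]) (simp add: keys_mon_add weight_add mdeg_add)
qed

text \<open>Trade \<open>x\<^sub>i^a\<close> for \<open>t\<close>.\<close>

lemma has_long_x1_mate_if_exceeds:
  assumes "a \<le> lookup m i" "weight n t = a * n i" "X1 \<in> keys t" "a \<le> mdeg t"
  shows "has_long_x1_mate m"
proof -
  have "has_long_x1_mate (single i a)" using assms by (auto simp: has_long_x1_mate_def)
  then have "has_long_x1_mate ((m - single i a) + single i a)" by (rule has_long_x1_mate_add)
  then show ?thesis using mon_split_single[OF assms(1)] by (simp add: add.commute)
qed

text \<open>A top-degree monomial of weight \<open>s + n\<^sub>1\<close> may be replaced by one divisible by \<open>x\<^sub>1\<close>;
  dividing by \<open>x\<^sub>1\<close> gives a monomial of weight \<open>s\<close>.\<close>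

lemma max_degree_plus_n_X1:
  assumes "\<And>m. has_x1_mate m \<Longrightarrow> has_long_x1_mate m"
  shows "max_degree (weight n m + n X1) = max_degree (weight n m) + 1"
proof (rule antisym)
  obtain q where q: "weight n q = weight n (m + single X1 1)" "mdeg q = max_degree (weight n (m + single X1 1))"
    by (rule max_degree_attained)
  then have "has_x1_mate q" by (auto simp: has_x1_mate_def keys_mon_add intro!: exI[of _ "m + single X1 1"])
  then obtain p where p: "X1 \<in> keys p" "weight n p = weight n q" "mdeg q \<le> mdeg p"
    using assms by (auto simp: has_long_x1_mate_def)
  define p' where "p' = p - single X1 1"
  have p': "p = single X1 1 + p'"
    unfolding p'_def using p(1) by (intro mon_split_single) (simp add: in_keys_iff)
  then have "weight n p' = weight n m" using p q by (simp add: weight_add)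
  then have "mdeg p' \<le> max_degree (weight n m)" using mdeg_le_max_degree by metis
  then show "max_degree (weight n m + n X1) \<le> max_degree (weight n m) + 1"
    using p q p' by (simp add: weight_add mdeg_add)
next
  obtain q where "weight n q = weight n m" "mdeg q = max_degree (weight n m)"
    by (rule max_degree_attained)
  then show "max_degree (weight n m) + 1 \<le> max_degree (weight n m + n X1)"
    using mdeg_le_max_degree[of "q + single X1 1"] by (simp add: weight_add mdeg_add)
qed

lemma mdeg_times_n_X1_le_weight: "mdeg m * n X1 \<le> weight n m"
  unfolding mdeg_def weight_def sum_distrib_right
proof (intro sum_mono mult_le_mono2)
  fix i show "n X1 \<le> n i" using n_X1_less[of i] by (cases "i = X1") auto
qed

lemma le_mdeg_if_n_maximal:
  assumes "\<And>j. n j \<le> n i" "weight n t = a * n i"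
  shows "a \<le> mdeg t"
proof -
  have "weight n t \<le> mdeg t * n i"
    unfolding mdeg_def weight_def sum_distrib_right by (intro sum_mono mult_le_mono2 assms(1))
  then show ?thesis using assms(2) n_pos[of i] by simp
qed

lemma long_x1_mates_if_liftable:
  assumes "\<And>a b c. P a b c \<Longrightarrow> liftable TYPE('k::field) n a b c"
    and "\<And>m. X1 \<notin> keys m \<Longrightarrow> \<not> P (lookup m X2) (lookup m X3) (lookup m X4) \<Longrightarrow> has_long_x1_mate m"
    and "has_x1_mate m"
  shows "has_long_x1_mate m"
  using assms has_long_x1_mateI_divisible mon_eq_mon234 liftable_iff by metis

lemma card_UNIV_xvar: "card (UNIV :: xvar set) = 4"
  by (simp add: UNIV_xvar)

text \<open>Here \<open>t i\<close> is the monomial that \<open>x\<^sub>i\<close> to its critical exponent trades for.\<close>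

context
  fixes t :: "xvar \<Rightarrow> mon"
  assumes crit: "\<And>i. weight n (t i) = crit_exp n i * n i" "\<And>i. i \<notin> keys (t i)"
    and X1_t: "\<And>i. i \<noteq> X1 \<Longrightarrow> X1 \<in> keys (t i)"
begin

lemma crit_exp_le_if_power:
  assumes "keys m \<subseteq> {i}" "weight n q = weight n m" "i \<notin> keys q" "m \<noteq> 0"
  shows "crit_exp n i \<le> lookup m i"
proof (rule crit_exp_le)
  have m: "m = single i (lookup m i)" using mon_eq_single assms by blast
  show "weight n q = lookup m i * n i" using assms(2) m weight_single by metis
  show "0 < lookup m i" using m assms(4) by (metis gr0I single_zero)
qed (rule assms)

text \<open>Let \<open>g\<close> be the common factor of \<open>m\<close> and \<open>q\<close>, with cofactors \<open>m1\<close> and \<open>q1\<close>. If \<open>x\<^sub>1\<close> divides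
  \<open>q\<close>, cancelling a variable contradicts minimality. Otherwise \<open>m1\<close> and \<open>q1\<close> are coprime
  monomials in three variables, so one of them is a power of a variable. It cannot be \<open>m1\<close>,
  whose exponents lie below the critical ones. If \<open>q1\<close> is a power of \<open>x\<^sub>k\<close>, then \<open>x\<^sub>k\<close> to its
  critical exponent divides \<open>q1\<close> and trades for a monomial containing \<open>x\<^sub>1\<close>, so the proper
  divisor \<open>m1\<close> of \<open>m\<close> already has its weight in \<open>n\<^sub>1 + S\<close>.\<close>

lemma minimal_with_x1_mate_isolated:
  assumes X1: "X1 \<notin> keys m" and small: "\<And>i. i \<noteq> X1 \<Longrightarrow> lookup m i < crit_exp n i"
    and minimal: "\<And>d r. m = d + r \<Longrightarrow> d \<noteq> 0 \<Longrightarrow> \<not> has_x1_mate r"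
    and q: "weight n q = weight n m" "q \<noteq> m"
  shows "keys q \<inter> keys m = {}"
proof (rule ccontr)
  assume "keys q \<inter> keys m \<noteq> {}"
  then obtain i where i: "i \<in> keys q" "i \<in> keys m" by blast
  show False
  proof (cases "X1 \<in> keys q")
    case True
    have m: "m = single i 1 + (m - single i 1)" and qs: "q = single i 1 + (q - single i 1)"
      using i by (auto intro!: mon_split_single simp: in_keys_iff)
    have "weight n (q - single i 1) = weight n (m - single i 1)"
      using q(1) m qs by (metis add_left_cancel weight_add)
    moreover have "X1 \<in> keys (q - single i 1)"
      using True X1 i by (auto simp: in_keys_iff lookup_minus lookup_single when_def)
    ultimately have "has_x1_mate (m - single i 1)" by (auto simp: has_x1_mate_def)
    moreover have "single i 1 \<noteq> (0 :: mon)" by (metis mdeg_single mdeg_zero one_neq_zero)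
    ultimately show False using minimal[OF m] by simp
  next
    case False
    define m1 where "m1 = m - q"
    define q1 where "q1 = q - m"
    \<comment> \<open>Subtraction of exponents truncates at zero, so \<open>g\<close> is the greatest common divisor.\<close>
    define g where "g = m - m1"
    have m: "m = g + m1" and qs: "q = g + q1"
      by (auto simp: m1_def q1_def g_def lookup_add lookup_minus intro!: poly_mapping_eqI)
    have disj: "keys m1 \<inter> keys q1 = {}"
      by (auto simp: m1_def q1_def in_keys_iff lookup_minus)
    have w: "weight n m1 = weight n q1" using q(1) m qs by (metis add_left_cancel weight_add)
    have "m1 \<noteq> q1" using q(2) m qs by auto
    then have nz: "m1 \<noteq> 0" "q1 \<noteq> 0" using w weight_eq_0_iff by metis+
    have "lookup g i \<noteq> 0" using i by (simp add: g_def m1_def lookup_minus in_keys_iff)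
    then have "g \<noteq> 0" by auto
    have keys: "keys m1 \<subseteq> keys m" "keys q1 \<subseteq> keys q" using m qs by (metis keys_mon_add Un_upper2)+
    have not_power_q1: "\<not> keys q1 \<subseteq> {k}" for k
    proof
      assume k: "keys q1 \<subseteq> {k}"
      then have q1: "q1 = single k (lookup q1 k)" by (rule mon_eq_single)
      have "k \<in> keys q1" using k nz by (metis keys_eq_empty subset_singletonD insertI1)
      then have "k \<notin> keys m1" "k \<noteq> X1" using disj keys False by auto
      then have le: "crit_exp n k \<le> lookup q1 k" using crit_exp_le_if_power[OF k w] nz by simp
      have "weight n (t k + single k (lookup q1 k - crit_exp n k)) = weight n (single k (lookup q1 k))"
        using le by (simp add: weight_add crit flip: add_mult_distrib)
      moreover have "X1 \<in> keys (t k + single k (lookup q1 k - crit_exp n k))"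
        using X1_t \<open>k \<noteq> X1\<close> by (simp add: keys_mon_add)
      ultimately have "has_x1_mate m1" using w q1 by (auto simp: has_x1_mate_def)
      then show False using minimal[OF m] \<open>g \<noteq> 0\<close> by simp
    qed
    have not_power_m1: "\<not> keys m1 \<subseteq> {k}" for k
    proof
      assume k: "keys m1 \<subseteq> {k}"
      have "k \<in> keys m1" using k nz by (metis keys_eq_empty subset_singletonD insertI1)
      then have "k \<notin> keys q1" "k \<noteq> X1" using disj keys X1 by auto
      then have "crit_exp n k \<le> lookup m1 k" using crit_exp_le_if_power[OF k w[symmetric]] nz by simp
      also have "\<dots> \<le> lookup m k" by (simp add: m1_def lookup_minus)
      finally show False using small \<open>k \<noteq> X1\<close> by (meson not_less)
    qed
    obtain a b where ab: "a \<in> keys m1" "b \<in> keys m1" "a \<noteq> b" using not_power_m1 nz by blast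
    obtain c d where cd: "c \<in> keys q1" "d \<in> keys q1" "c \<noteq> d" using not_power_q1 nz by blast
    have "X1 \<notin> {a, b, c, d}" "{a, b} \<inter> {c, d} = {}" using ab cd disj keys False X1 by auto
    then have "card {X1, a, b, c, d} = 5" using ab cd by auto
    moreover have "card {X1, a, b, c, d} \<le> card (UNIV :: xvar set)" by (rule card_mono) auto
    ultimately show False by (simp add: card_UNIV_xvar)
  qed
qed

text \<open>Take \<open>p\<close> of the same weight with the largest possible exponent of \<open>x\<^sub>1\<close>. If \<open>p\<close> is a power
  of \<open>x\<^sub>1\<close>, its degree is large because \<open>n\<^sub>1\<close> is the smallest weight. Otherwise isolation leaves
  only \<open>p = x\<^sub>1^b x\<^sub>k^c\<close> and \<open>m = x\<^sub>i^d x\<^sub>j^e\<close> with four different variables. Both \<open>b\<close> and \<open>c\<close> lie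
  below the critical exponents: for \<open>c\<close> by the choice of \<open>p\<close>, for \<open>b\<close> because otherwise \<open>a\<^sub>1 n\<^sub>1\<close>
  would be a multiple of \<open>n\<^sub>k\<close>. As \<open>m\<close> is indispensable, \<open>p - m\<close> is one of the binomials whose
  degrees are controlled.\<close>

lemma minimal_with_x1_mate:
  assumes case1: "\<And>i. i \<noteq> X1 \<Longrightarrow> crit_exp n i * n i \<noteq> crit_exp n X1 * n X1"
    and indisp: "\<And>p q. (xpow p - xpow q :: 'k::field mpoly4) \<in> indisp_binomials n \<Longrightarrow> X1 \<in> keys p
        \<Longrightarrow> mdeg q \<le> mdeg p"
    and X1: "X1 \<notin> keys m" and small: "\<And>i. i \<noteq> X1 \<Longrightarrow> lookup m i < crit_exp n i"
    and minimal: "\<And>d r. m = d + r \<Longrightarrow> d \<noteq> 0 \<Longrightarrow> \<not> has_x1_mate r"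
    and mate: "has_x1_mate m"
  shows "has_long_x1_mate m"
proof -
  have isolated: "keys q \<inter> keys m = {}" if "weight n q = weight n m" "q \<noteq> m" for q
    by (rule minimal_with_x1_mate_isolated) (fact X1 small minimal that)+
  obtain p where p: "X1 \<in> keys p" "weight n p = weight n m"
    and max: "\<And>p'. X1 \<in> keys p' \<Longrightarrow> weight n p' = weight n m \<Longrightarrow> lookup p' X1 \<le> lookup p X1"
  proof -
    have "\<exists>p. (X1 \<in> keys p \<and> weight n p = weight n m)
      \<and> (\<forall>p'. X1 \<in> keys p' \<and> weight n p' = weight n m \<longrightarrow> lookup p' X1 \<le> lookup p X1)"
    proof -
      obtain p0 where "X1 \<in> keys p0 \<and> weight n p0 = weight n m" using mate by (auto simp: has_x1_mate_def)
      moreover have "\<forall>p. X1 \<in> keys p \<and> weight n p = weight n m \<longrightarrow> lookup p X1 < Suc (weight n m)"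
        using lookup_le_weight by (metis less_Suc_eq_le)
      ultimately show ?thesis
        by (rule Lattices_Big.ex_has_greatest_nat[where f = "\<lambda>p. lookup p X1"])
    qed
    then show ?thesis using that by blast
  qed
  have "p \<noteq> m" using p X1 by auto
  then have disj: "keys p \<inter> keys m = {}" using isolated p by blast
  have m0: "m \<noteq> 0" using p by (metis keys_zero empty_iff weight_eq_0_iff weight_zero)
  show ?thesis
  proof (cases "keys p \<subseteq> {X1}")
    case True
    then have "weight n p = mdeg p * n X1" by (metis mdeg_single mon_eq_single weight_single)
    then have "mdeg m * n X1 \<le> mdeg p * n X1" using mdeg_times_n_X1_le_weight[of m] p by simp
    then have "mdeg m \<le> mdeg p" using n_pos[of X1] by simp
    then show ?thesis using p by (auto simp: has_long_x1_mate_def)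
  next
    case False
    then obtain k where k: "k \<in> keys p" "k \<noteq> X1" by blast
    have "\<not> keys m \<subseteq> {i}" for i
    proof
      assume i: "keys m \<subseteq> {i}"
      then have "i \<in> keys m" using m0 by (metis keys_eq_empty subset_singletonD insertI1)
      then have "i \<notin> keys p" "i \<noteq> X1" using disj X1 by auto
      then have "crit_exp n i \<le> lookup m i" using crit_exp_le_if_power[OF i p(2)] m0 by simp
      then show False using small[OF \<open>i \<noteq> X1\<close>] by simp
    qed
    then obtain i j where ij: "i \<in> keys m" "j \<in> keys m" "i \<noteq> j" using m0 by blast
    have distinct: "X1 \<noteq> k" "X1 \<noteq> i" "X1 \<noteq> j" "k \<noteq> i" "k \<noteq> j" "k \<notin> keys m" using k ij X1 disj by auto
    have UNIV: "{X1, k, i, j} = UNIV"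
    proof (rule card_subset_eq)
      show "card {X1, k, i, j} = card (UNIV :: xvar set)" using distinct ij by (simp add: card_UNIV_xvar)
    qed auto
    have all: "P x" if "P X1" "P k" "P i" "P j" for P and x :: xvar
    proof -
      have "x \<in> {X1, k, i, j}" unfolding UNIV by simp
      then show ?thesis using that by auto
    qed
    have zero: "lookup p i = 0" "lookup p j = 0" "lookup m X1 = 0" "lookup m k = 0"
      using disj ij k X1 by (auto simp: in_keys_iff)
    have p_eq: "p = single X1 (lookup p X1) + single k (lookup p k)"
    proof (rule poly_mapping_eqI)
      show "lookup p x = lookup (single X1 (lookup p X1) + single k (lookup p k)) x" for x
        by (rule all[of _ x]) (use distinct zero ij in \<open>simp_all add: lookup_add lookup_single when_def\<close>)
    qed
    have m_eq: "m = single i (lookup m i) + single j (lookup m j)"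
    proof (rule poly_mapping_eqI)
      show "lookup m x = lookup (single i (lookup m i) + single j (lookup m j)) x" for x
        by (rule all[of _ x]) (use distinct zero ij in \<open>simp_all add: lookup_add lookup_single when_def\<close>)
    qed
    have w: "weight n m = lookup p X1 * n X1 + lookup p k * n k"
      using p(2) p_eq by (metis weight_add weight_single)
    have c: "lookup p k < crit_exp n k"
    proof (rule ccontr)
      assume "\<not> lookup p k < crit_exp n k"
      then have c: "lookup p k = crit_exp n k + (lookup p k - crit_exp n k)" by simp
      let ?p' = "single X1 (lookup p X1) + single k (lookup p k - crit_exp n k) + t k"
      have "weight n ?p' = weight n m"
        unfolding w by (subst (2) c) (simp add: weight_add crit algebra_simps)
      moreover have "X1 \<in> keys ?p'" using X1_t k by (simp add: keys_mon_add)
      ultimately have "lookup ?p' X1 \<le> lookup p X1" using max by blast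
      then have "lookup (t k) X1 = 0" by (simp add: lookup_add)
      then show False using X1_t[OF k(2)] by (simp add: in_keys_iff)
    qed
    have b: "lookup p X1 < crit_exp n X1"
    proof (rule ccontr)
      assume "\<not> lookup p X1 < crit_exp n X1"
      then have b: "lookup p X1 = crit_exp n X1 + (lookup p X1 - crit_exp n X1)" by simp
      let ?p' = "single X1 (lookup p X1 - crit_exp n X1) + single k (lookup p k) + t X1"
      have "weight n ?p' = weight n m"
        unfolding w by (subst (2) b) (simp add: weight_add crit algebra_simps)
      moreover have "k \<in> keys ?p'" using k by (simp add: keys_mon_add in_keys_iff)
      then have "?p' \<noteq> m" using distinct by metis
      ultimately have "keys ?p' \<inter> keys m = {}" using isolated by blast
      then have ij': "i \<notin> keys (t X1)" "j \<notin> keys (t X1)" using ij by (auto simp: keys_mon_add)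
      have u: "keys (t X1) \<subseteq> {k}"
      proof
        show "x \<in> keys (t X1) \<Longrightarrow> x \<in> {k}" for x
          by (rule all[of "\<lambda>x. x \<in> keys (t X1) \<longrightarrow> x \<in> {k}" x, THEN mp]) (use ij' crit(2)[of X1] in auto)
      qed
      \<comment> \<open>Now \<open>a\<^sub>1 n\<^sub>1 = e n\<^sub>k\<close> with \<open>e \<ge> a\<^sub>k\<close>; trading \<open>x\<^sub>k^a\<^sub>k\<close> brings back a factor \<open>x\<^sub>1^f\<close>, and
        cancelling it contradicts the minimality of \<open>a\<^sub>1\<close>, or makes two critical weights equal.\<close>
      define e where "e = lookup (t X1) k"
      have u_eq: "t X1 = single k e" unfolding e_def using u by (rule mon_eq_single)
      have we: "e * n k = crit_exp n X1 * n X1" using crit(1)[of X1] u_eq by simp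
      have "0 < e"
      proof (rule ccontr)
        assume "\<not> 0 < e"
        then have "crit_exp n X1 = 0" using we n_pos[of X1] by simp
        then show False using crit_exp_pos[of n X2 X1] n_pos[of X2] by simp
      qed
      have "crit_exp n k \<le> e"
        by (rule crit_exp_le[of _ _ "single X1 (crit_exp n X1)"]) (use \<open>0 < e\<close> we k in auto)
      define f where "f = lookup (t k) X1"
      define r where "r = single k (e - crit_exp n k) + (t k - single X1 f)"
      have tk: "t k = single X1 f + (t k - single X1 f)" unfolding f_def by (rule mon_split_single) simp
      have "weight n (single X1 f + r) = weight n (single k (e - crit_exp n k)) + weight n (t k)"
        using arg_cong[OF tk, of "weight n"] by (simp add: r_def weight_add)
      also have "\<dots> = e * n k" using \<open>crit_exp n k \<le> e\<close> by (simp add: crit(1) flip: add_mult_distrib)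
      finally have wr: "f * n X1 + weight n r = crit_exp n X1 * n X1" using we by (simp add: weight_add)
      have "0 < f" using X1_t[OF k(2)] by (simp add: f_def in_keys_iff)
      have "X1 \<notin> keys r"
        using k by (simp add: r_def f_def in_keys_iff lookup_add lookup_minus lookup_single when_def)
      have "f * n X1 \<le> crit_exp n X1 * n X1" using wr by linarith
      then have "f \<le> crit_exp n X1" using n_pos[of X1] by simp
      show False
      proof (cases "f = crit_exp n X1")
        case True
        then have "r = 0" using wr by simp
        then have "e = crit_exp n k" using \<open>crit_exp n k \<le> e\<close>
          by (simp add: r_def poly_mapping_eq_iff fun_eq_iff lookup_add lookup_single when_def)
            (metis diff_is_0_eq le_antisym)
        then show False using we case1[OF k(2)] by simp
      next
        case False
        have "weight n r = (crit_exp n X1 - f) * n X1" using wr by (simp add: diff_mult_distrib)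
        then have "crit_exp n X1 \<le> crit_exp n X1 - f"
          using False \<open>f \<le> crit_exp n X1\<close> \<open>X1 \<notin> keys r\<close> by (intro crit_exp_le[of _ n r]) auto
        then show False using \<open>0 < f\<close> \<open>f \<le> crit_exp n X1\<close> by simp
      qed
    qed
    have "indispensable TYPE('k) n m"
      using isolated p(2) \<open>p \<noteq> m\<close> by (rule indispensable_if_isolated)
    then have "(xpow p - xpow m :: 'k mpoly4) \<in> indisp_binomials n"
      using UNIV p_eq m_eq p b c small[of i] small[of j] k ij distinct
      by (intro indisp_binomialsI[of X1 k i j "lookup p X1" n "lookup p k" "lookup m i" "lookup m j"])
        (auto simp: in_keys_iff)
    then have "mdeg m \<le> mdeg p" using indisp p by blast
    then show ?thesis using p by (auto simp: has_long_x1_mate_def)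
  qed
qed

text \<open>Descent on the degree of \<open>m\<close> to the minimal monomials.\<close>

lemma long_x1_mates_if_indispensable_binomials:
  assumes case1: "\<And>i. i \<noteq> X1 \<Longrightarrow> crit_exp n i * n i \<noteq> crit_exp n X1 * n X1"
    and indisp: "\<And>p q. (xpow p - xpow q :: 'k::field mpoly4) \<in> indisp_binomials n \<Longrightarrow> X1 \<in> keys p
        \<Longrightarrow> mdeg q \<le> mdeg p"
    and long: "\<And>i. i \<noteq> X1 \<Longrightarrow> crit_exp n i \<le> mdeg (t i)"
    and mate: "has_x1_mate m"
  shows "has_long_x1_mate m"
  using mate
proof (induction "mdeg m" arbitrary: m rule: less_induct)
  case less
  consider "X1 \<in> keys m" | i where "i \<noteq> X1" "crit_exp n i \<le> lookup m i"
    | d r where "m = d + r" "d \<noteq> 0" "has_x1_mate r"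
    | "X1 \<notin> keys m" "\<And>i. i \<noteq> X1 \<Longrightarrow> lookup m i < crit_exp n i"
      "\<And>d r. m = d + r \<Longrightarrow> d \<noteq> 0 \<Longrightarrow> \<not> has_x1_mate r"
    by (meson not_less)
  then show ?case
  proof cases
    case 1
    then show ?thesis by (rule has_long_x1_mateI_divisible)
  next
    case 2
    then show ?thesis using has_long_x1_mate_if_exceeds crit X1_t long by blast
  next
    case 3
    have "mdeg d \<noteq> 0" using \<open>d \<noteq> 0\<close> by (auto simp: mdeg_def poly_mapping_eq_iff fun_eq_iff)
    then have "has_long_x1_mate r" using less.hyps[of r] 3 by (simp add: mdeg_add)
    then show ?thesis using 3 has_long_x1_mate_add by simp
  next
    case 4
    show ?thesis by (rule minimal_with_x1_mate) (fact case1 indisp 4 less.prems)+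
  qed
qed

end

end


section \<open>Cohen--Macaulay tangent cones\<close>

theorem proposition2p5:
  fixes n :: "xvar \<Rightarrow> nat" and u v w z :: mon
  assumes "0 < n X1" "n X1 < n X2" "n X2 < n X3" "n X3 < n X4"
    and "Gcd (range n) = 1"
    and case1: "\<And>i j. i \<noteq> j \<Longrightarrow> crit_exp n i * n i \<noteq> crit_exp n j * n j"
    and "critical_binomial n X1 (crit_diff n X1 u :: 'k::field mpoly4)"
    and "critical_binomial n X2 (crit_diff n X2 v :: 'k mpoly4)"
    and "critical_binomial n X3 (crit_diff n X3 w :: 'k mpoly4)"
    and "critical_binomial n X4 (crit_diff n X4 z :: 'k mpoly4)"
    and "genideal mpoly4_ring {crit_diff n X1 u, crit_diff n X2 v, crit_diff n X3 w, crit_diff n X4 z}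
           = (critical_ideal n :: 'k mpoly4 set)"
    and "X1 \<in> Poly_Mapping.keys v"
  shows
    "(X1 \<in> Poly_Mapping.keys w \<and> X1 \<in> Poly_Mapping.keys z \<and>
      crit_exp n X2 \<le> mdeg v \<and> crit_exp n X3 \<le> mdeg w \<and>
      (\<forall>M N. (xpow M - xpow N :: 'k mpoly4) \<in> indisp_binomials n \<and> X1 \<in> Poly_Mapping.keys M
         \<longrightarrow> mdeg N \<le> mdeg M)
      \<longrightarrow> cm_tangent_cone TYPE('k) n) \<and>
     (X1 \<in> Poly_Mapping.keys w \<and> X1 \<notin> Poly_Mapping.keys z \<and>
      crit_exp n X2 \<le> mdeg v \<and> crit_exp n X3 \<le> mdeg w \<and>
      (\<forall>d2 d3 d4. d2 < crit_exp n X2 \<and> d3 < crit_exp n X3 \<longrightarrow> liftable TYPE('k) n d2 d3 d4)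
      \<longrightarrow> cm_tangent_cone TYPE('k) n) \<and>
     (X1 \<notin> Poly_Mapping.keys w \<and> X1 \<in> Poly_Mapping.keys z \<and>
      crit_exp n X2 \<le> mdeg v \<and>
      (\<forall>d2 d3 d4. d2 < crit_exp n X2 \<and> d4 < crit_exp n X4 \<longrightarrow> liftable TYPE('k) n d2 d3 d4)
      \<longrightarrow> cm_tangent_cone TYPE('k) n) \<and>
     (X1 \<notin> Poly_Mapping.keys w \<and> X1 \<notin> Poly_Mapping.keys z \<and>
      crit_exp n X2 \<le> mdeg v \<and>
      (\<forall>d2 d3 d4. d2 < crit_exp n X2 \<longrightarrow> liftable TYPE('k) n d2 d3 d4)
      \<longrightarrow> cm_tangent_cone TYPE('k) n)"
proof -
  interpret numerical_weights n
  proof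
    show "0 < n i" for i using assms(1-4) by (cases i) simp_all
    show "n X1 < n i" if "i \<noteq> X1" for i using assms(1-4) that by (cases i) simp_all
  qed
  have cm: "cm_tangent_cone TYPE('k) n" if "\<And>m. has_x1_mate m \<Longrightarrow> has_long_x1_mate m"
    using max_degree_plus_n_X1[OF that] by (rule cm_tangent_coneI)
  note v = critical_binomialD[OF assms(8)] and w = critical_binomialD[OF assms(9)]
    and z = critical_binomialD[OF assms(10)]
  have z_long: "crit_exp n X4 \<le> mdeg z"
  proof (rule le_mdeg_if_n_maximal[OF _ z(1)])
    show "n j \<le> n X4" for j using assms(1-4) by (cases j) simp_all
  qed
  have exceeds_v: "has_long_x1_mate m" if "crit_exp n X2 \<le> mdeg v" "\<not> lookup m X2 < crit_exp n X2" for m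
    using that v(1) assms(12) by (intro has_long_x1_mate_if_exceeds[of "crit_exp n X2" m X2 v]) auto
  have exceeds_w: "has_long_x1_mate m"
    if "X1 \<in> keys w" "crit_exp n X3 \<le> mdeg w" "\<not> lookup m X3 < crit_exp n X3" for m
    using that w(1) by (intro has_long_x1_mate_if_exceeds[of "crit_exp n X3" m X3 w]) auto
  have exceeds_z: "has_long_x1_mate m" if "X1 \<in> keys z" "\<not> lookup m X4 < crit_exp n X4" for m
    using that z(1) z_long by (intro has_long_x1_mate_if_exceeds[of "crit_exp n X4" m X4 z]) auto
  show ?thesis
  proof (intro conjI impI; elim conjE)
    assume X1: "X1 \<in> keys w" "X1 \<in> keys z"
      and long: "crit_exp n X2 \<le> mdeg v" "crit_exp n X3 \<le> mdeg w"
      and indisp: "\<forall>M N. (xpow M - xpow N :: 'k mpoly4) \<in> indisp_binomials n \<and> X1 \<in> keys M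
         \<longrightarrow> mdeg N \<le> mdeg M"
    define t where "t i = (case i of X1 \<Rightarrow> u | X2 \<Rightarrow> v | X3 \<Rightarrow> w | X4 \<Rightarrow> z)" for i
    have t: "weight n (t i) = crit_exp n i * n i" "i \<notin> keys (t i)" for i
      using critical_binomialD[OF assms(7)] v w z by (cases i; simp add: t_def)+
    have X1_t: "X1 \<in> keys (t i)" "crit_exp n i \<le> mdeg (t i)" if "i \<noteq> X1" for i
      using that X1 assms(12) long z_long by (cases i; simp add: t_def)+
    show "cm_tangent_cone TYPE('k) n"
    proof (rule cm)
      fix m assume "has_x1_mate m"
      then show "has_long_x1_mate m"
      proof (rule long_x1_mates_if_indispensable_binomials[where t = t and 'k = 'k, rotated -1])
        show "crit_exp n i * n i \<noteq> crit_exp n X1 * n X1" if "i \<noteq> X1" for i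
          using case1 that by blast
        show "mdeg q \<le> mdeg p" if "(xpow p - xpow q :: 'k mpoly4) \<in> indisp_binomials n" "X1 \<in> keys p" for p q
          using indisp that by blast
      qed (fact t X1_t)+
    qed
  next
    assume hyps: "X1 \<in> keys w" "crit_exp n X2 \<le> mdeg v" "crit_exp n X3 \<le> mdeg w"
      and lift: "\<forall>d2 d3 d4. d2 < crit_exp n X2 \<and> d3 < crit_exp n X3 \<longrightarrow> liftable TYPE('k) n d2 d3 d4"
    from hyps show "cm_tangent_cone TYPE('k) n"
      by (intro cm, elim long_x1_mates_if_liftable[of "\<lambda>d2 d3 d4. d2 < crit_exp n X2 \<and> d3 < crit_exp n X3", rotated 2])
        (use lift in \<open>auto intro: exceeds_v exceeds_w\<close>)
  next
    assume hyps: "X1 \<in> keys z" "crit_exp n X2 \<le> mdeg v"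
      and lift: "\<forall>d2 d3 d4. d2 < crit_exp n X2 \<and> d4 < crit_exp n X4 \<longrightarrow> liftable TYPE('k) n d2 d3 d4"
    from hyps show "cm_tangent_cone TYPE('k) n"
      by (intro cm, elim long_x1_mates_if_liftable[of "\<lambda>d2 d3 d4. d2 < crit_exp n X2 \<and> d4 < crit_exp n X4", rotated 2])
        (use lift in \<open>auto intro: exceeds_v exceeds_z\<close>)
  next
    assume hyps: "crit_exp n X2 \<le> mdeg v"
      and lift: "\<forall>d2 d3 d4. d2 < crit_exp n X2 \<longrightarrow> liftable TYPE('k) n d2 d3 d4"
    from hyps show "cm_tangent_cone TYPE('k) n"
      by (intro cm, elim long_x1_mates_if_liftable[of "\<lambda>d2 d3 d4. d2 < crit_exp n X2", rotated 2])
        (use lift in \<open>auto intro: exceeds_v\<close>)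
  qed
qed

end
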